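(* Let $p$ be a prime number and let $q=p^f$ with $f\ge 1$. For any $a \in \mathbb{Q}_q$, $\Psi_q(a) \in \mathbb{Z}_q$.
   Context: $\mathbb{Q}_q$ is the unramified extension of $\mathbb{Q}_p$ of degree $f$ and $\mathbb{Z}_q$ is its ring of integers. $\Psi_q(T) \in T + T^2\mathbb{Z}[[T]]$ is the unique power series of this form satisfying $\sum_{j=0}^\infty p^{-j}\Psi_q(p^jT)^{q^j} = T$; it is $p$-adically entire, so $\Psi_q(a)$ makes sense for every $a\in\mathbb{Q}_q$. *)

theory Defs
  imports
    "HOL-Analysis.Abstract_Metric_Spaces"
    "HOL-Computational_Algebra.Formal_Power_Series"
    "HOL-Computational_Algebra.Primes"
begin

section \<open>The power series \<open>\<Psi>\<^sub>q\<close>\<close>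

unbundle no vec_syntax
unbundle fps_syntax

text \<open>The infinite sum of power series is taken in the \<open>T\<close>-adic topology, which is the topology
  that the library puts on the type of formal power series.\<close>

definition is_Psi :: "nat \<Rightarrow> nat \<Rightarrow> rat fps \<Rightarrow> bool" where
  "is_Psi p q F \<longleftrightarrow>
     F $ 0 = 0 \<and> F $ 1 = 1 \<and> (\<forall>n\<ge>2. F $ n \<in> \<int>) \<and>
     (\<lambda>j. fps_const (1 / of_nat p ^ j) *
           (F oo (fps_const (of_nat p ^ j) * fps_X)) ^ (q ^ j)) sums fps_X"

definition Psi :: "nat \<Rightarrow> nat \<Rightarrow> rat fps" where
  "Psi p q = (THE F. is_Psi p q F)"

text \<open>Existence and uniqueness: comparing coefficients of \<open>T\<^sup>n\<close> in the functional equation expresses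
  \<open>F $ n\<close> through the earlier coefficients of \<open>F\<close>.\<close>

lemma fps_power_nth_agree:
  fixes F G :: "'a::comm_ring_1 fps"
  assumes "\<And>k. k \<le> n \<Longrightarrow> F $ k = G $ k"
  shows "k \<le> n \<Longrightarrow> (F ^ m) $ k = (G ^ m) $ k"
proof (induction m arbitrary: k)
  case (Suc m)
  have "(F * F ^ m) $ k = (G * G ^ m) $ k"
    unfolding fps_mult_nth
  proof (rule sum.cong)
    fix i assume "i \<in> {0..k}"
    then show "F $ i * F ^ m $ (k - i) = G $ i * G ^ m $ (k - i)"
      using Suc assms[of i] by auto
  qed simp
  then show ?case by simp
qed simp

lemma fps_power_nth_agree_less:
  fixes F G :: "'a::idom fps"
  assumes agree: "\<And>k. k < n \<Longrightarrow> F $ k = G $ k"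
    and F0: "F $ 0 = 0" and G0: "G $ 0 = 0" and m: "m \<ge> 2"
  shows "(F ^ m) $ n = (G ^ m) $ n"
proof -
  obtain l where l: "m = Suc l" "l > 0" using m by (cases m) auto
  have "(F * F ^ l) $ n = (G * G ^ l) $ n"
    unfolding fps_mult_nth
  proof (rule sum.cong)
    fix i assume i: "i \<in> {0..n}"
    consider "i = 0" | "i = n" "i \<noteq> 0" | "0 < i" "i < n" using i by fastforce
    then show "F $ i * F ^ l $ (n - i) = G $ i * G ^ l $ (n - i)"
    proof cases
      case 3
      have "F ^ l $ (n - i) = G ^ l $ (n - i)"
        by (rule fps_power_nth_agree[of "n - i"]) (use 3 agree in auto)
      then show ?thesis using 3 agree by simp
    qed (use F0 G0 l in \<open>auto simp: startsby_zero_power\<close>)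
  qed simp
  then show ?thesis by (simp add: l)
qed

lemma fps_power_nth_Ints:
  fixes F :: "'a::comm_ring_1 fps"
  assumes "\<And>k. F $ k \<in> \<int>"
  shows "(F ^ m) $ n \<in> \<int>"
proof (induction m arbitrary: n)
  case (Suc m)
  then show ?case using assms by (auto simp: fps_mult_nth intro!: Ints_sum Ints_mult)
qed (auto simp: fps_one_nth)

lemma fps_compose_linear_power_nth:
  fixes F :: "'a::comm_ring_1 fps"
  shows "((F oo (fps_const c * fps_X)) ^ m) $ n = c ^ n * (F ^ m) $ n"
proof (induction m arbitrary: n)
  case (Suc m)
  have "(F oo (fps_const c * fps_X)) ^ Suc m $ n
      = (\<Sum>i=0..n. (c ^ i * F $ i) * (c ^ (n - i) * F ^ m $ (n - i)))"
    by (simp add: fps_mult_nth Suc)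
  also have "\<dots> = (\<Sum>i=0..n. c ^ n * (F $ i * F ^ m $ (n - i)))"
  proof (rule sum.cong)
    fix i assume "i \<in> {0..n}"
    then have "c ^ n = c ^ i * c ^ (n - i)" by (simp flip: power_add)
    then show "(c ^ i * F $ i) * (c ^ (n - i) * F ^ m $ (n - i)) = c ^ n * (F $ i * F ^ m $ (n - i))"
      by (simp only: mult_ac)
  qed simp
  finally show ?case by (simp add: fps_mult_nth sum_distrib_left)
qed (auto simp: fps_one_nth)

lemma Psi_equation_iff:
  fixes F :: "rat fps"
  assumes q: "q \<ge> 2" and F0: "F $ 0 = 0"
  shows "(\<lambda>j. fps_const (1 / of_nat p ^ j) *
           (F oo (fps_const (of_nat p ^ j) * fps_X)) ^ (q ^ j)) sums fps_X \<longleftrightarrow>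
    (\<forall>n. F $ n = fps_X $ n -
       (\<Sum>j=1..n. 1 / of_nat p ^ j * (of_nat p ^ j) ^ n * (F ^ (q ^ j)) $ n))"
    (is "?w sums _ \<longleftrightarrow> ?R")
proof -
  define c where
    "c = (\<lambda>j n. 1 / of_nat p ^ j * (of_nat p ^ j) ^ n * (F ^ (q ^ j)) $ n)"
  have w: "?w j $ n = c j n" for j n
    by (simp add: fps_compose_linear_power_nth c_def)
  have c0: "c j n = 0" if "n < j" for j n
  proof -
    have "j < 2 ^ j" by simp
    also have "\<dots> \<le> q ^ j" using q by (intro power_mono) auto
    finally have "n < q ^ j" using that by simp
    then show ?thesis using F0 startsby_zero_power_prefix[of F "q ^ j"] by (simp add: c_def)
  qed
  have part: "(\<Sum>j<N. ?w j) $ n = (\<Sum>j\<le>n. c j n)" if "n < N" for n N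
  proof -
    have "(\<Sum>j<N. ?w j) $ n = (\<Sum>j<N. c j n)"
      unfolding fps_sum_nth w ..
    also have "\<dots> = (\<Sum>j\<le>n. c j n)"
      by (rule sum.mono_neutral_right) (use that c0 in auto)
    finally show ?thesis .
  qed
  have split: "(\<Sum>j\<le>n. c j n) = F $ n + (\<Sum>j=1..n. c j n)" for n
  proof -
    have "{..n} = insert 0 {1..n}" by auto
    then have "(\<Sum>j\<le>n. c j n) = c 0 n + (\<Sum>j=1..n. c j n)" by simp
    then show ?thesis by (simp add: c_def)
  qed
  have "?w sums fps_X \<longleftrightarrow> (\<forall>n. eventually (\<lambda>N. (\<Sum>j<N. ?w j) $ n = fps_X $ n) sequentially)"
    unfolding sums_def tendsto_fps_iff ..
  also have "\<dots> \<longleftrightarrow> (\<forall>n. (\<Sum>j\<le>n. c j n) = fps_X $ n)"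
  proof (intro iff_allI)
    fix n
    have ev: "eventually (\<lambda>N. (\<Sum>j<N. ?w j) $ n = (\<Sum>j\<le>n. c j n)) sequentially"
      using eventually_gt_at_top[of n] by eventually_elim (rule part)
    show "eventually (\<lambda>N. (\<Sum>j<N. ?w j) $ n = fps_X $ n) sequentially \<longleftrightarrow>
          (\<Sum>j\<le>n. c j n) = fps_X $ n" (is "?E \<longleftrightarrow> ?Q")
    proof
      assume ?E
      with ev have "eventually (\<lambda>N::nat. ?Q) sequentially"
        by eventually_elim simp
      then show ?Q by simp
    next
      assume ?Q
      with ev show ?E by simp
    qed
  qed
  also have "\<dots> \<longleftrightarrow> ?R"
    unfolding split c_def[symmetric] by (auto simp: c_def algebra_simps)
  finally show ?thesis .
qed

fun Psi_coeff :: "nat \<Rightarrow> nat \<Rightarrow> nat \<Rightarrow> rat" where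
  "Psi_coeff p q n = fps_X $ n -
     (\<Sum>j=1..n. 1 / of_nat p ^ j * (of_nat p ^ j) ^ n *
        ((Abs_fps (\<lambda>k. if k < n then Psi_coeff p q k else 0)) ^ (q ^ j)) $ n)"

declare Psi_coeff.simps [simp del]

lemma ex1_is_Psi:
  assumes p: "p > 0" and q: "q \<ge> 2"
  shows "\<exists>!F. is_Psi p q F"
proof (rule ex_ex1I)
  have qj: "q ^ j \<ge> 2" if "j \<ge> 1" for j
    using q self_le_power[of q j] that by linarith
  define F where "F = Abs_fps (Psi_coeff p q)"
  have F0: "F $ 0 = 0" by (simp add: F_def Psi_coeff.simps)
  have rec: "F $ n = fps_X $ n -
       (\<Sum>j=1..n. 1 / of_nat p ^ j * (of_nat p ^ j) ^ n * (F ^ (q ^ j)) $ n)" for n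
  proof (cases "n = 0")
    case True
    then show ?thesis by (simp add: F0)
  next
    case n: False
    define G where "G = Abs_fps (\<lambda>k. if k < n then Psi_coeff p q k else 0)"
    have "(G ^ (q ^ j)) $ n = (F ^ (q ^ j)) $ n" if "j \<in> {1..n}" for j
      by (rule fps_power_nth_agree_less)
         (use that n F0 qj[of j] in \<open>auto simp: G_def F_def\<close>)
    then show ?thesis
      by (simp add: F_def Psi_coeff.simps[of p q n] flip: G_def)
  qed
  have Ints: "F $ n \<in> \<int>" for n
  proof (induction n rule: less_induct)
    case (less n)
    show ?case
    proof (cases "n = 0")
      case True
      then show ?thesis by (simp add: F0)
    next
      case n: False
      define G where "G = Abs_fps (\<lambda>k. if k < n then F $ k else 0)"
      have GI: "(G ^ m) $ i \<in> \<int>" for m i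
        by (rule fps_power_nth_Ints) (auto simp: G_def less)
      have FI: "(F ^ (q ^ j)) $ n \<in> \<int>" if "j \<in> {1..n}" for j
      proof -
        have "(F ^ (q ^ j)) $ n = (G ^ (q ^ j)) $ n"
          by (rule fps_power_nth_agree_less)
             (use that n F0 qj[of j] in \<open>auto simp: G_def\<close>)
        then show ?thesis using GI by simp
      qed
      have cI: "1 / of_nat p ^ j * (of_nat p ^ j) ^ n \<in> (\<int> :: rat set)" for j
      proof -
        obtain l where "n = Suc l" using n by (cases n) auto
        then have "1 / of_nat p ^ j * (of_nat p ^ j) ^ n = (of_nat ((p ^ j) ^ l) :: rat)"
          using p by simp
        then show ?thesis by (metis Ints_of_nat)
      qed
      show ?thesis
        by (subst rec) (intro Ints_diff Ints_sum Ints_mult[OF cI] FI, auto)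
    qed
  qed
  have F1: "F $ 1 = 1"
  proof -
    have "(F ^ q) $ 1 = 0"
      using startsby_zero_power_prefix[of F q] F0 q by auto
    then show ?thesis by (subst rec) simp
  qed
  show "\<exists>F. is_Psi p q F"
    unfolding is_Psi_def
    by (intro exI[of _ F] conjI F0 F1 allI impI Ints iffD2[OF Psi_equation_iff[OF q F0]] rec)
  fix F G assume "is_Psi p q F" "is_Psi p q G"
  then have F: "F $ 0 = 0" "\<And>n. F $ n = fps_X $ n -
       (\<Sum>j=1..n. 1 / of_nat p ^ j * (of_nat p ^ j) ^ n * (F ^ (q ^ j)) $ n)"
    and G: "G $ 0 = 0" "\<And>n. G $ n = fps_X $ n -
       (\<Sum>j=1..n. 1 / of_nat p ^ j * (of_nat p ^ j) ^ n * (G ^ (q ^ j)) $ n)"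
    unfolding is_Psi_def using Psi_equation_iff[OF q, of F p] Psi_equation_iff[OF q, of G p]
    by blast+
  have "F $ n = G $ n" for n
  proof (induction n rule: less_induct)
    case (less n)
    have "(F ^ (q ^ j)) $ n = (G ^ (q ^ j)) $ n" if "j \<in> {1..n}" for j
      by (rule fps_power_nth_agree_less) (use that F(1) G(1) less qj[of j] in auto)
    then show ?case by (subst F(2), subst G(2)) simp
  qed
  then show "F = G" by (simp add: fps_eq_iff)
qed

lemma is_Psi_Psi:
  assumes "p > 0" "q \<ge> 2"
  shows "is_Psi p q (Psi p q)"
  unfolding Psi_def by (rule theI'[OF ex1_is_Psi[OF assms]])


section \<open>Fields with a non-archimedean absolute value\<close>

locale nonarch_field =
  fixes absv :: "'a::field_char_0 \<Rightarrow> real"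
  assumes absv_nonneg: "absv x \<ge> 0"
    and absv_eq_0_iff: "absv x = 0 \<longleftrightarrow> x = 0"
    and absv_mult: "absv (x * y) = absv x * absv y"
    and absv_add_le_max: "absv (x + y) \<le> max (absv x) (absv y)"
begin

lemma absv_1: "absv 1 = 1"
  using absv_mult[of 1 1] absv_eq_0_iff[of 1] by simp

lemma absv_minus: "absv (- x) = absv x"
proof -
  have "absv (-1) * absv (-1) = 1"
    using absv_mult[of "-1" "-1"] absv_1 by simp
  then have "absv (-1) = 1"
    using absv_nonneg[of "-1"] by (simp add: square_eq_1_iff)
  then show ?thesis using absv_mult[of "-1" x] by simp
qed

sublocale Metric_space UNIV "\<lambda>x y. absv (x - y)"
proof
  fix x y z :: 'a
  show "0 \<le> absv (x - y)" by (rule absv_nonneg)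
  show "absv (x - y) = absv (y - x)" using absv_minus[of "x - y"] by simp
  show "absv (x - y) = 0 \<longleftrightarrow> x = y" by (simp add: absv_eq_0_iff)
  have "absv (x - z) \<le> max (absv (x - y)) (absv (y - z))"
    using absv_add_le_max[of "x - y" "y - z"] by simp
  then show "absv (x - z) \<le> absv (x - y) + absv (y - z)"
    using absv_nonneg[of "x - y"] absv_nonneg[of "y - z"] by linarith
qed

definition ring_of_integers :: "'a set" where
  "ring_of_integers = {x. absv x \<le> 1}"

definition has_value_at :: "rat fps \<Rightarrow> 'a \<Rightarrow> 'a \<Rightarrow> bool" where
  "has_value_at F a s \<longleftrightarrow>
     limitin mtopology (\<lambda>N. \<Sum>n<N. of_rat (F $ n) * a ^ n) s sequentially"

definition converges_at :: "rat fps \<Rightarrow> 'a \<Rightarrow> bool" where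
  "converges_at F a \<longleftrightarrow> (\<exists>s. has_value_at F a s)"

definition value_at :: "rat fps \<Rightarrow> 'a \<Rightarrow> 'a" where
  "value_at F a = (THE s. has_value_at F a s)"

lemma value_at_eq: "has_value_at F a s \<Longrightarrow> value_at F a = s"
  unfolding value_at_def has_value_at_def
  by (rule the_equality) (auto dest: limitin_metric_unique[OF _ _ sequentially_bot])

end


section \<open>\<open>\<rat>\<^sub>p\<close> and its unramified extensions\<close>

definition padic_abs :: "nat \<Rightarrow> rat \<Rightarrow> real" where
  "padic_abs p r =
     (if r = 0 then 0
      else let (m, n) = quotient_of r
           in real p powi (int (multiplicity (int p) n) - int (multiplicity (int p) m)))"

text \<open>Up to isometric isomorphism, the field \<open>\<rat>\<^sub>p\<close> with its absolute value is the completion of \<open>\<rat>\<close>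
  with respect to \<open>padic_abs p\<close>.\<close>

locale padic_numbers = nonarch_field absv for absv :: "'k::field_char_0 \<Rightarrow> real" +
  fixes p :: nat
  assumes prime_p: "prime p"
    and absv_of_rat: "absv (of_rat r) = padic_abs p r"
    and complete: "mcomplete"
    and dense_rat: "mtopology closure_of (range of_rat) = UNIV"

text \<open>\<open>emb\<close> is the inclusion of \<open>\<rat>\<^sub>p\<close> (the type \<open>'k\<close>) into the extension (the type \<open>'a\<close>), and
  \<open>absq\<close> is the unique extension of the \<open>p\<close>-adic absolute value. Since \<open>dim\<close> is \<open>0\<close> for spaces that
  have no finite basis, \<open>f_pos\<close> makes the condition \<open>degree\<close> say that the extension is finite.
  Unramified means ramification index 1, that is, equality of the value groups.\<close>

locale unramified_padic_extension =
  Qp: padic_numbers absp p + Qq: nonarch_field absq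
  for absp :: "'k::field_char_0 \<Rightarrow> real" and p :: nat
    and absq :: "'a::field_char_0 \<Rightarrow> real" +
  fixes emb :: "'k \<Rightarrow> 'a" and f :: nat
  assumes emb_1: "emb 1 = 1"
    and emb_add: "emb (x + y) = emb x + emb y"
    and emb_mult: "emb (x * y) = emb x * emb y"
    and absq_emb: "absq (emb x) = absp x"
    and f_pos: "f \<ge> 1"
    and degree: "vector_space.dim (\<lambda>c v. emb c * v) (UNIV :: 'a set) = f"
    and unramified: "absq ` (UNIV - {0}) = absp ` (UNIV - {0})"
begin

sublocale vector_space "\<lambda>c v. emb c * v"
  by unfold_locales (simp_all add: emb_1 emb_add emb_mult algebra_simps)

end

end

theory Submission
  imports Defs
begin

text \<open>Bounding the Gauss norms of the terms of the functional equation shows, by induction on \<open>k\<close>, that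
  \<open>\<Psi>\<^sub>q\<close> has finite Gauss norm on every disc of radius \<open>p\<^sup>k\<close>, so it is entire. Integrality at \<open>a\<close> is
  proved by induction on \<open>k\<close> with \<open>\<bar>a\<bar> \<le> p\<^sup>k\<close>: eliminating \<open>a\<close> between the functional equations at
  \<open>a\<close> and \<open>p a\<close> expresses \<open>\<Psi>\<^sub>q(a)\<close> through the integral numbers \<open>\<Psi>\<^sub>q(p\<^sup>j a)\<close>, \<open>j \<ge> 1\<close>, and the
  congruence \<open>x\<^sup>q \<equiv> x\<close> modulo \<open>p\<close> makes the result integral. That congruence needs a residue field
  with exactly \<open>q\<close> elements. Integral lifts of a basis of the residue field over \<open>\<int>/p\<close> form an
  orthonormal basis of the extension; this gives the count, and also completeness.\<close>

section \<open>Power series over a non-archimedean field\<close>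

lemma cauchy_product_sum:
  fixes u v :: "nat \<Rightarrow> 'b::comm_ring_1"
  shows "(\<Sum>n<N. \<Sum>i=0..n. u i * v (n - i)) =
         (\<Sum>(i, j)\<in>{(i, j). i + j < N}. u i * v j)"
proof -
  have "(\<Sum>n<N. \<Sum>i=0..n. u i * v (n - i)) =
        (\<Sum>(n, i)\<in>(SIGMA n:{..<N}. {0..n}). u i * v (n - i))"
    by (simp add: sum.Sigma)
  also have "\<dots> = (\<Sum>(i, j)\<in>{(i, j). i + j < N}. u i * v j)"
    by (rule sum.reindex_bij_witness[of _ "\<lambda>(i, j). (i + j, i)" "\<lambda>(n, i). (i, n - i)"]) auto
  finally show ?thesis .
qed

context nonarch_field
begin

section \<open>Consequences of the ultrametric inequality\<close>

lemma absv_0 [simp]: "absv 0 = 0"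
  by (simp add: absv_eq_0_iff)

lemma absv_minus_commute: "absv (x - y) = absv (y - x)"
  using absv_minus[of "x - y"] by simp

lemma absv_add_le: "absv x \<le> C \<Longrightarrow> absv y \<le> C \<Longrightarrow> absv (x + y) \<le> C"
  using absv_add_le_max[of x y] by linarith

lemma absv_diff_le: "absv x \<le> C \<Longrightarrow> absv y \<le> C \<Longrightarrow> absv (x - y) \<le> C"
  using absv_add_le[of x C "- y"] by (simp add: absv_minus)

lemma absv_power: "absv (x ^ n) = absv x ^ n"
  by (induction n) (simp_all add: absv_1 absv_mult)

lemma absv_inverse: "absv (inverse x) = inverse (absv x)"
proof (cases "x = 0")
  case False
  then have "absv x * absv (inverse x) = 1"
    using absv_mult[of x "inverse x"] by (simp add: absv_1)
  then show ?thesis by (simp add: inverse_unique)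
qed simp

lemma absv_divide: "absv (x / y) = absv x / absv y"
  by (simp add: divide_inverse absv_mult absv_inverse)

lemma absv_prod: "absv (prod h A) = (\<Prod>i\<in>A. absv (h i))"
  by (induction A rule: infinite_finite_induct) (simp_all add: absv_1 absv_mult)

lemma absv_sum_le:
  assumes "0 \<le> C" "\<And>i. i \<in> A \<Longrightarrow> absv (h i) \<le> C"
  shows "absv (sum h A) \<le> C"
  using assms(2)
  by (induction A rule: infinite_finite_induct) (auto simp: assms(1) intro: absv_add_le)

lemma absv_sum_less:
  assumes "0 < C" "finite A" "\<And>i. i \<in> A \<Longrightarrow> absv (h i) < C"
  shows "absv (sum h A) < C"
  using assms(2,3)
proof (induction A rule: finite_induct)
  case (insert x F)
  then show ?case
    using absv_add_le_max[of "h x" "sum h F"] by (simp, smt (verit))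
qed (simp add: assms(1))

lemma absv_of_nat_le_1: "absv (of_nat n) \<le> 1"
  by (induction n) (auto simp: absv_1 intro: absv_add_le)

lemma absv_of_int_le_1: "absv (of_int n) \<le> 1"
  by (cases n) (simp_all only: of_int_of_nat_eq of_int_minus absv_minus absv_of_nat_le_1)

text \<open>The isosceles principle: the ultrametric inequality for \<open>x = (x - y) + y\<close>
  and for \<open>y = (y - x) + x\<close> bounds each absolute value by the other.\<close>

lemma absv_eq_of_diff_less:
  assumes "absv (x - y) < absv y"
  shows "absv x = absv y"
proof -
  have "absv x \<le> max (absv (x - y)) (absv y)"
    using absv_add_le_max[of "x - y" y] by simp
  moreover have "absv y \<le> max (absv (y - x)) (absv x)"
    using absv_add_le_max[of "y - x" x] by simp
  ultimately show ?thesis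
    using assms by (simp add: absv_minus_commute)
qed

lemma limitin_iff_tendsto:
  "limitin mtopology h l sequentially \<longleftrightarrow> (\<lambda>n. absv (h n - l)) \<longlonglongrightarrow> 0"
  by (simp add: limitin_metric tendsto_iff dist_real_def absv_nonneg)

section \<open>Gauss norms on discs\<close>

text \<open>The supremum of \<open>absv (F $ n) * R ^ n\<close> is the Gauss norm on the disc of
  radius \<open>R\<close>; bounding it by \<open>C\<close> avoids a supremum that may be
  infinite.\<close>

definition gauss_le :: "real \<Rightarrow> real \<Rightarrow> 'a fps \<Rightarrow> bool" where
  "gauss_le R C F \<longleftrightarrow> (\<forall>n. absv (F $ n) * R ^ n \<le> C)"

lemma gauss_leD: "gauss_le R C F \<Longrightarrow> absv (F $ n) * R ^ n \<le> C"
  by (simp add: gauss_le_def)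

lemma gauss_le_nonneg: "gauss_le R C F \<Longrightarrow> 0 \<le> C"
  using gauss_leD[of R C F 0] absv_nonneg[of "F $ 0"] by simp

lemma gauss_le_mono_radius:
  assumes "gauss_le R C F" "0 \<le> R'" "R' \<le> R"
  shows "gauss_le R' C F"
  unfolding gauss_le_def
proof
  fix n
  have "absv (F $ n) * R' ^ n \<le> absv (F $ n) * R ^ n"
    by (intro mult_left_mono power_mono assms absv_nonneg)
  then show "absv (F $ n) * R' ^ n \<le> C"
    using gauss_leD[OF assms(1), of n] by linarith
qed

text \<open>By the ultrametric inequality a coefficient of the product is at most its largest
  summand, and \<open>R ^ n\<close> splits as \<open>R ^ i * R ^ (n - i)\<close> for each
  summand.\<close>

lemma gauss_le_mult:
  assumes F: "gauss_le R C F" and G: "gauss_le R D G" and R: "0 < R"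
  shows "gauss_le R (C * D) (F * G)"
  unfolding gauss_le_def
proof
  fix n
  have "absv ((F * G) $ n) \<le> C * D / R ^ n"
    unfolding fps_mult_nth
  proof (rule absv_sum_le)
    show "0 \<le> C * D / R ^ n"
      using gauss_le_nonneg[OF F] gauss_le_nonneg[OF G] R by simp
    fix i assume i: "i \<in> {0..n}"
    have "(absv (F $ i) * R ^ i) * (absv (G $ (n - i)) * R ^ (n - i)) \<le> C * D"
      using R by (intro mult_mono gauss_leD F G gauss_le_nonneg[OF F])
                 (simp add: absv_nonneg)
    moreover have "R ^ n = R ^ i * R ^ (n - i)"
      using i by (simp flip: power_add)
    ultimately show "absv (F $ i * G $ (n - i)) \<le> C * D / R ^ n"
      using R by (simp add: absv_mult field_simps)
  qed
  then show "absv ((F * G) $ n) * R ^ n \<le> C * D"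
    using R by (simp add: field_simps)
qed

lemma gauss_le_power:
  assumes "gauss_le R C F" "0 < R"
  shows "gauss_le R (C ^ m) (F ^ m)"
proof (induction m)
  case 0
  show ?case by (auto simp: gauss_le_def fps_one_nth absv_1)
next
  case (Suc m)
  then show ?case using gauss_le_mult[OF assms(1) Suc assms(2)] by simp
qed

section \<open>Evaluation of power series at a point\<close>

text \<open>Coefficients lie in the field itself, so that Gauss norms apply;
  \<open>has_value_at_iff_evals\<close> returns to rational series.\<close>

definition evals :: "'a fps \<Rightarrow> 'a \<Rightarrow> 'a \<Rightarrow> bool" where
  "evals F a s \<longleftrightarrow> (\<lambda>N. absv ((\<Sum>n<N. F $ n * a ^ n) - s)) \<longlonglongrightarrow> 0"

lemma evals_unique:
  assumes "evals F a s" "evals F a t"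
  shows "s = t"
  using assms unfolding evals_def limitin_iff_tendsto[symmetric]
  by (rule limitin_metric_unique[OF _ _ sequentially_bot])

lemma evals_if_eventually:
  assumes "eventually (\<lambda>N. (\<Sum>n<N. F $ n * a ^ n) = s) sequentially"
  shows "evals F a s"
  unfolding evals_def
  by (rule tendsto_eventually, rule eventually_mono[OF assms]) simp

lemma evals_const: "evals (fps_const c) a c"
proof (rule evals_if_eventually)
  have "(\<Sum>n<N. fps_const c $ n * a ^ n) = c" if "N > 0" for N
  proof -
    have "(\<Sum>n<N. fps_const c $ n * a ^ n) = (\<Sum>n\<in>{0}. fps_const c $ n * a ^ n)"
      by (rule sum.mono_neutral_right) (use that in auto)
    then show ?thesis by simp
  qed
  then show "eventually (\<lambda>N. (\<Sum>n<N. fps_const c $ n * a ^ n) = c) sequentially"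
    using eventually_gt_at_top[of 0] by (rule eventually_mono[rotated])
qed

lemma evals_X: "evals fps_X a a"
proof (rule evals_if_eventually)
  have "(\<Sum>n<N. fps_X $ n * a ^ n) = a" if "N > 1" for N
  proof -
    have "(\<Sum>n<N. fps_X $ n * a ^ n) = (\<Sum>n\<in>{1}. fps_X $ n * a ^ n)"
      by (rule sum.mono_neutral_right) (use that in \<open>auto simp: fps_X_def\<close>)
    then show ?thesis by simp
  qed
  then show "eventually (\<lambda>N. (\<Sum>n<N. fps_X $ n * a ^ n) = a) sequentially"
    using eventually_gt_at_top[of 1] by (rule eventually_mono[rotated])
qed

lemma evals_diff:
  assumes "evals F a s" "evals G a t"
  shows "evals (F - G) a (s - t)"
  unfolding evals_def
proof (rule tendsto_sandwich[OF always_eventually always_eventually tendsto_const])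
  show "(\<lambda>N. absv ((\<Sum>n<N. F $ n * a ^ n) - s) + absv ((\<Sum>n<N. G $ n * a ^ n) - t)) \<longlonglongrightarrow> 0"
    using tendsto_add[OF assms[unfolded evals_def]] by simp
  show "\<forall>N. absv ((\<Sum>n<N. (F - G) $ n * a ^ n) - (s - t))
       \<le> absv ((\<Sum>n<N. F $ n * a ^ n) - s) + absv ((\<Sum>n<N. G $ n * a ^ n) - t)"
  proof
    fix N
    have "(\<Sum>n<N. (F - G) $ n * a ^ n) - (s - t)
        = ((\<Sum>n<N. F $ n * a ^ n) - s) - ((\<Sum>n<N. G $ n * a ^ n) - t)"
      by (simp add: algebra_simps sum_subtractf)
    also have "absv \<dots> \<le> absv ((\<Sum>n<N. F $ n * a ^ n) - s) + absv ((\<Sum>n<N. G $ n * a ^ n) - t)"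
      by (rule absv_diff_le) (simp_all add: absv_nonneg)
    finally show "absv ((\<Sum>n<N. (F - G) $ n * a ^ n) - (s - t)) \<le> \<dots>" .
  qed
qed (simp add: absv_nonneg)

lemma evals_sum:
  assumes "\<And>i. i \<in> A \<Longrightarrow> evals (F i) a (s i)"
  shows "evals (sum F A) a (sum s A)"
  using assms
proof (induction A rule: infinite_finite_induct)
  case (insert x A)
  \<comment> \<open>Addition is reduced to \<open>evals_diff\<close> by writing \<open>F + G\<close>
    as \<open>F - (0 - G)\<close>.\<close>
  have "evals (F x - (0 - sum F A)) a (s x - (0 - sum s A))"
    using insert evals_const[of 0 a] by (intro evals_diff) auto
  then show ?case using insert by simp
qed (use evals_const[of 0 a] in simp_all)

lemma evals_terms_tendsto_0:
  assumes "evals F a s"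
  shows "(\<lambda>n. absv (F $ n * a ^ n)) \<longlonglongrightarrow> 0"
proof (rule tendsto_sandwich[OF always_eventually always_eventually tendsto_const])
  let ?S = "\<lambda>N. (\<Sum>n<N. F $ n * a ^ n) - s"
  have *: "(\<lambda>N. absv (?S N)) \<longlonglongrightarrow> 0"
    using assms unfolding evals_def .
  show "(\<lambda>N. absv (?S (Suc N)) + absv (?S N)) \<longlonglongrightarrow> 0"
    using tendsto_add[OF LIMSEQ_Suc[OF *] *] by simp
  show "\<forall>N. absv (F $ N * a ^ N) \<le> absv (?S (Suc N)) + absv (?S N)"
  proof
    fix N
    have "absv (?S (Suc N) - ?S N) \<le> absv (?S (Suc N)) + absv (?S N)"
      by (rule absv_diff_le) (simp_all add: absv_nonneg)
    then show "absv (F $ N * a ^ N) \<le> absv (?S (Suc N)) + absv (?S N)" by simp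
  qed
qed (simp add: absv_nonneg)

text \<open>The product of two partial sums exceeds the partial sum of the product by the terms
  \<open>u i * v j\<close> with \<open>i, j < N \<le> i + j\<close>. One of the two indices is large
  there, so the ultrametric inequality makes this excess tend to 0.\<close>

lemma evals_mult:
  assumes F: "evals F a s" and G: "evals G a t"
  shows "evals (F * G) a (s * t)"
proof -
  define u where "u n = F $ n * a ^ n" for n
  define v where "v n = G $ n * a ^ n" for n
  define U where "U N = (\<Sum>n<N. u n)" for N
  define V where "V N = (\<Sum>n<N. v n)" for N
  have u0: "(\<lambda>n. absv (u n)) \<longlonglongrightarrow> 0" and v0: "(\<lambda>n. absv (v n)) \<longlonglongrightarrow> 0"
    using evals_terms_tendsto_0[OF F] evals_terms_tendsto_0[OF G] by (simp_all add: u_def v_def)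
  obtain K where K: "K > 0" "\<And>n. absv (u n) \<le> K" "\<And>n. absv (v n) \<le> K"
  proof -
    obtain K1 where K1: "\<forall>n. norm (absv (u n)) \<le> K1"
      using convergent_imp_Bseq[OF convergentI[OF u0]] by (auto simp: Bseq_def)
    obtain K2 where K2: "\<forall>n. norm (absv (v n)) \<le> K2"
      using convergent_imp_Bseq[OF convergentI[OF v0]] by (auto simp: Bseq_def)
    show ?thesis
      by (rule that[of "max 1 (max K1 K2)"]) (use K1 K2 in \<open>auto simp: absv_nonneg le_max_iff_disj\<close>)
  qed
  define P where "P N = (\<Sum>n<N. (F * G) $ n * a ^ n)" for N
  have P: "P N = (\<Sum>(i, j)\<in>{(i, j). i + j < N}. u i * v j)" for N
  proof -
    have "(F * G) $ n * a ^ n = (\<Sum>i=0..n. u i * v (n - i))" for n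
      unfolding fps_mult_nth sum_distrib_right
    proof (rule sum.cong)
      fix i assume "i \<in> {0..n}"
      then have "a ^ n = a ^ i * a ^ (n - i)" by (simp flip: power_add)
      then show "F $ i * G $ (n - i) * a ^ n = u i * v (n - i)"
        by (simp add: u_def v_def mult_ac)
    qed simp
    then show ?thesis by (simp add: P_def cauchy_product_sum)
  qed
  have UV: "U N * V N - P N = (\<Sum>(i, j)\<in>{(i, j). i < N \<and> j < N \<and> N \<le> i + j}. u i * v j)" for N
  proof -
    have "U N * V N = (\<Sum>(i, j)\<in>{..<N} \<times> {..<N}. u i * v j)"
      by (simp add: U_def V_def sum_product sum.cartesian_product)
    also have "\<dots> = (\<Sum>(i, j)\<in>{..<N} \<times> {..<N} - {(i, j). i + j < N}. u i * v j) + P N"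
      unfolding P by (rule sum.subset_diff) auto
    also have "{..<N} \<times> {..<N} - {(i, j). i + j < N} = {(i, j). i < N \<and> j < N \<and> N \<le> i + j}"
      by auto
    finally show ?thesis by simp
  qed
  have lim1: "(\<lambda>N. absv (U N * V N - P N)) \<longlonglongrightarrow> 0"
  proof (rule LIMSEQ_I)
    fix e :: real assume "e > 0"
    \<comment> \<open>The factor 2 makes \<open>d * K\<close> strictly smaller than
      \<open>e\<close>.\<close>
    define d where "d = e / (2 * K)"
    have d: "d > 0" using \<open>e > 0\<close> K(1) by (simp add: d_def)
    obtain M1 where M1: "\<And>n. n \<ge> M1 \<Longrightarrow> absv (u n) < d"
      using LIMSEQ_D[OF u0 d] by (auto simp: absv_nonneg)
    obtain M2 where M2: "\<And>n. n \<ge> M2 \<Longrightarrow> absv (v n) < d"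
      using LIMSEQ_D[OF v0 d] by (auto simp: absv_nonneg)
    \<comment> \<open>If \<open>i + j \<ge> M1 + M2\<close>, then at least one of the two factors is
      below \<open>d\<close>; the other is at most \<open>K\<close>.\<close>
    have "absv (U N * V N - P N) < e" if N: "N \<ge> M1 + M2" for N
    proof -
      have "absv (U N * V N - P N) \<le> d * K"
        unfolding UV
      proof (rule absv_sum_le)
        fix x assume x: "x \<in> {(i, j). i < N \<and> j < N \<and> N \<le> i + j}"
        obtain i j where ij: "x = (i, j)" by fastforce
        then consider "i \<ge> M1" | "j \<ge> M2" using N x by fastforce
        then show "absv (case x of (i, j) \<Rightarrow> u i * v j) \<le> d * K"
        proof cases
          case 1
          then show ?thesis
            using mult_mono[of "absv (u i)" d "absv (v j)" K] M1[of i] K(3)[of j] d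
            by (simp add: ij absv_mult absv_nonneg)
        next
          case 2
          then show ?thesis
            using mult_mono[of "absv (v j)" d "absv (u i)" K] M2[of j] K(2)[of i] d
            by (simp add: ij absv_mult absv_nonneg mult_ac)
        qed
      qed (use d K in simp)
      also have "d * K < e" using \<open>e > 0\<close> K(1) by (simp add: d_def)
      finally show ?thesis .
    qed
    then show "\<exists>N0. \<forall>N\<ge>N0. norm (absv (U N * V N - P N) - 0) < e"
      by (auto simp: absv_nonneg)
  qed
  have U: "(\<lambda>N. absv (U N - s)) \<longlonglongrightarrow> 0" and V: "(\<lambda>N. absv (V N - t)) \<longlonglongrightarrow> 0"
    using F G by (simp_all add: evals_def U_def V_def u_def v_def)
  show ?thesis
    unfolding evals_def P_def[symmetric]
  proof (rule tendsto_sandwich[OF always_eventually always_eventually tendsto_const])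
    let ?B = "\<lambda>N. absv (U N * V N - P N) + absv (U N - s) * absv (V N - t)
       + absv s * absv (V N - t) + absv t * absv (U N - s)"
    show "?B \<longlonglongrightarrow> 0"
      using tendsto_add[OF tendsto_add[OF tendsto_add[OF lim1 tendsto_mult[OF U V]]
              tendsto_mult[OF tendsto_const[of "absv s"] V]] tendsto_mult[OF tendsto_const[of "absv t"] U]]
      by simp
    show "\<forall>N. absv (P N - s * t) \<le> ?B N"
    proof
      fix N
      have eq: "P N - s * t = ((U N - s) * (V N - t) + s * (V N - t) + t * (U N - s))
          - (U N * V N - P N)"
        by (simp add: algebra_simps)
      show "absv (P N - s * t) \<le> ?B N"
        unfolding eq
        by (rule absv_diff_le, (rule absv_add_le)+) (simp_all add: absv_mult absv_nonneg)
    qed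
  qed (simp add: absv_nonneg)
qed

lemma evals_power: "evals F a s \<Longrightarrow> evals (F ^ m) a (s ^ m)"
  using evals_const[of 1 a] by (induction m) (auto intro: evals_mult)

lemma evals_compose_linear:
  assumes "evals F (c * a) s"
  shows "evals (F oo (fps_const c * fps_X)) a s"
  using assms fps_compose_linear_power_nth[of F c 1] by (simp add: evals_def power_mult_distrib mult_ac)

text \<open>One half of the maximum principle: the partial sums obey the bound by the ultrametric
  inequality, and it passes to the limit.\<close>

lemma evals_gauss_le:
  assumes s: "evals F a s" and F: "gauss_le R C F" and a: "absv a \<le> R"
  shows "absv s \<le> C"
proof -
  let ?S = "\<lambda>N. \<Sum>n<N. F $ n * a ^ n"
  have S: "absv (?S N) \<le> C" for N
  proof (rule absv_sum_le[OF gauss_le_nonneg[OF F]])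
    fix n
    have "absv (F $ n * a ^ n) \<le> absv (F $ n) * R ^ n"
      unfolding absv_mult absv_power by (intro mult_left_mono power_mono a absv_nonneg)
    then show "absv (F $ n * a ^ n) \<le> C" using gauss_leD[OF F, of n] by linarith
  qed
  have "absv s \<le> C + absv (?S N - s)" for N
  proof -
    have "absv (?S N - (?S N - s)) \<le> C + absv (?S N - s)"
      by (rule absv_diff_le) (use S[of N] gauss_le_nonneg[OF F] in \<open>simp_all add: absv_nonneg add_increasing2\<close>)
    then show ?thesis by simp
  qed
  moreover have "(\<lambda>N. C + absv (?S N - s)) \<longlonglongrightarrow> C + 0"
    using s unfolding evals_def by (intro tendsto_add tendsto_const)
  ultimately show ?thesis
    using tendsto_lowerbound[of "\<lambda>N. C + absv (?S N - s)" "C + 0" sequentially "absv s"] by simp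
qed

text \<open>A block of consecutive terms is no larger than its largest term, so terms tending to 0
  are enough.\<close>

lemma MCauchy_partial_sums:
  assumes u: "(\<lambda>n. absv (u n)) \<longlonglongrightarrow> 0"
  shows "MCauchy (\<lambda>N. \<Sum>n<N. u n)"
  unfolding MCauchy_def
proof (intro conjI allI impI)
  fix e :: real assume e: "e > 0"
  obtain M where M: "\<And>n. n \<ge> M \<Longrightarrow> absv (u n) < e"
    using LIMSEQ_D[OF u e] by (auto simp: absv_nonneg)
  have *: "absv ((\<Sum>n<n'. u n) - (\<Sum>n<m. u n)) < e" if "M \<le> m" "m \<le> n'" for m n'
  proof -
    have "(\<Sum>n<n'. u n) - (\<Sum>n<m. u n) = (\<Sum>n=m..<n'. u n)"
      using sum_diff_nat_ivl[of 0 m n' u] that by (simp add: atLeast0LessThan)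
    also have "absv \<dots> < e" by (rule absv_sum_less) (use e M that in auto)
    finally show ?thesis .
  qed
  show "\<exists>N. \<forall>n n'. N \<le> n \<longrightarrow> N \<le> n' \<longrightarrow> absv ((\<Sum>n<n. u n) - (\<Sum>n<n'. u n)) < e"
  proof (intro exI[of _ M] allI impI)
    fix m n assume "M \<le> m" "M \<le> n"
    then show "absv ((\<Sum>n<m. u n) - (\<Sum>n<n. u n)) < e"
      using *[of m n] *[of n m] by (cases "m \<le> n") (auto simp: absv_minus_commute)
  qed
qed simp

text \<open>The terms decay geometrically with ratio \<open>absv a / R < 1\<close>.\<close>

lemma evals_exists_if_gauss_le:
  assumes complete: mcomplete and F: "gauss_le R C F" and a: "absv a < R"
  shows "\<exists>s. evals F a s"
proof -
  have R: "R > 0" using a absv_nonneg[of a] by linarith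
  define r where "r = absv a / R"
  have r: "0 \<le> r" "r < 1" using a R by (simp_all add: r_def absv_nonneg)
  have "(\<lambda>n. absv (F $ n * a ^ n)) \<longlonglongrightarrow> 0"
  proof (rule tendsto_sandwich[OF always_eventually always_eventually tendsto_const])
    show "(\<lambda>n. C * r ^ n) \<longlonglongrightarrow> 0"
      using tendsto_mult[OF tendsto_const[of C] LIMSEQ_power_zero[of r]] r by simp
    show "\<forall>n. absv (F $ n * a ^ n) \<le> C * r ^ n"
    proof
      fix n
      have "absv (F $ n * a ^ n) = absv (F $ n) * R ^ n * r ^ n"
        using R by (simp add: absv_mult absv_power r_def power_divide)
      also have "\<dots> \<le> C * r ^ n" by (intro mult_right_mono gauss_leD F) (use r in simp)
      finally show "absv (F $ n * a ^ n) \<le> C * r ^ n" .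
    qed
  qed (simp add: absv_nonneg)
  then have "MCauchy (\<lambda>N. \<Sum>n<N. F $ n * a ^ n)" by (rule MCauchy_partial_sums)
  then show ?thesis
    using complete by (auto simp: mcomplete_def evals_def limitin_iff_tendsto)
qed

definition lift_fps :: "rat fps \<Rightarrow> 'a fps" where
  "lift_fps F = Abs_fps (\<lambda>n. of_rat (F $ n))"

lemma lift_fps_nth [simp]: "lift_fps F $ n = of_rat (F $ n)"
  by (simp add: lift_fps_def)

lemma lift_fps_power_nth: "(lift_fps F ^ m) $ n = of_rat ((F ^ m) $ n)"
  by (induction m arbitrary: n) (simp_all add: fps_one_nth fps_mult_nth of_rat_sum of_rat_mult)

lemma has_value_at_iff_evals: "has_value_at F a s \<longleftrightarrow> evals (lift_fps F) a s"
  by (simp add: has_value_at_def evals_def limitin_iff_tendsto)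

end

section \<open>The value of \<open>\<Psi>\<^sub>q\<close>\<close>

context nonarch_field
begin

lemma gauss_le_const_mult: "gauss_le R C F \<Longrightarrow> gauss_le R (absv c * C) (fps_const c * F)"
  by (simp add: gauss_le_def absv_mult mult.assoc mult_left_mono absv_nonneg)

lemma gauss_le_compose_linear:
  assumes "gauss_le (R * absv c) C F"
  shows "gauss_le R C (F oo (fps_const c * fps_X))"
  using assms fps_compose_linear_power_nth[of F c 1]
  by (simp add: gauss_le_def absv_mult absv_power power_mult_distrib mult_ac)

text \<open>In the ring of integers \<open>u - v\<close> divides \<open>u ^ k - v ^ k\<close>; the
  induction peels off one factor at a time.\<close>

lemma absv_power_diff_le:
  assumes u: "absv u \<le> 1" and v: "absv v \<le> 1"
  shows "absv (u ^ k - v ^ k) \<le> absv (u - v)"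
proof (induction k)
  case 0
  show ?case by (simp add: absv_nonneg)
next
  case (Suc k)
  have eq: "u ^ Suc k - v ^ Suc k = u * (u ^ k - v ^ k) + (u - v) * v ^ k"
    by (simp add: algebra_simps)
  show ?case
    unfolding eq
  proof (rule absv_add_le)
    show "absv (u * (u ^ k - v ^ k)) \<le> absv (u - v)"
      using mult_mono[OF u Suc] by (simp add: absv_mult absv_nonneg)
    have "absv (v ^ k) \<le> 1" using v by (simp add: absv_power power_le_one absv_nonneg)
    then show "absv ((u - v) * v ^ k) \<le> absv (u - v)"
      by (simp add: absv_mult absv_nonneg mult_left_le)
  qed
qed

section \<open>Gauss norms of the terms of the functional equation\<close>

definition Psi_term :: "nat \<Rightarrow> nat \<Rightarrow> nat \<Rightarrow> 'a fps" where
  "Psi_term p q j = fps_const (1 / of_nat p ^ j) *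
     (lift_fps (Psi p q) oo (fps_const (of_nat p ^ j) * fps_X)) ^ (q ^ j)"

context
  fixes p q :: nat
  assumes p: "p \<ge> 2" and q: "q \<ge> 2" and absv_p: "absv (of_nat p) = 1 / real p"
begin

text \<open>Convergence in the \<open>T\<close>-adic topology means that each coefficient of the
  partial sums is eventually constant. The index \<open>M\<close> depends on \<open>n\<close> and
  can be taken beyond any prescribed \<open>N\<close>.\<close>

lemma Psi_term_sum:
  obtains M where "M \<ge> N" "(\<Sum>j<M. Psi_term p q j $ n) = fps_X $ n"
proof -
  define w where "w j = fps_const (1 / of_nat p ^ j) *
      (Psi p q oo (fps_const (of_nat p ^ j) * fps_X)) ^ (q ^ j)" for j
  have "w sums fps_X"
    using is_Psi_Psi[of p q] p q unfolding is_Psi_def w_def by simp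
  then have "eventually (\<lambda>N. (\<Sum>j<N. w j) $ n = fps_X $ n) sequentially"
    unfolding sums_def tendsto_fps_iff by blast
  then obtain M where M: "M \<ge> N" "(\<Sum>j<M. w j) $ n = fps_X $ n"
    using eventually_ge_at_top[of N] eventually_happens[OF eventually_conj] sequentially_bot
    by blast
  have "Psi_term p q j $ n = of_rat (w j $ n)" for j
    by (simp add: Psi_term_def w_def fps_compose_linear_power_nth lift_fps_power_nth
        of_rat_mult of_rat_divide of_rat_power)
  then have "(\<Sum>j<M. Psi_term p q j $ n) = of_rat ((\<Sum>j<M. w j) $ n)"
    by (simp add: fps_sum_nth of_rat_sum)
  also have "\<dots> = fps_X $ n" by (simp add: M(2) fps_X_def)
  finally show ?thesis using that M(1) by blast
qed

text \<open>The coefficients are integers and the constant term vanishes, so only the powers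
  \<open>r ^ n \<le> r\<close> with \<open>n \<ge> 1\<close> contribute.\<close>

lemma gauss_le_Psi_unit_disc:
  assumes "0 \<le> r" "r \<le> 1"
  shows "gauss_le r r (lift_fps (Psi p q))"
  unfolding gauss_le_def
proof
  fix n
  have Psi: "is_Psi p q (Psi p q)" using is_Psi_Psi[of p q] p q by simp
  show "absv (lift_fps (Psi p q) $ n) * r ^ n \<le> r"
  proof (cases n)
    case 0
    then show ?thesis using Psi assms by (simp add: is_Psi_def)
  next
    case (Suc m)
    have "Psi p q $ n \<in> \<int>"
      using Psi Suc by (cases m) (auto simp: is_Psi_def numeral_2_eq_2)
    then have "absv (lift_fps (Psi p q) $ n) \<le> 1"
      by (auto elim!: Ints_cases simp: absv_of_int_le_1)
    moreover have "r ^ n \<le> r"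
      using Suc assms by (simp add: mult_left_le power_le_one)
    ultimately have "absv (lift_fps (Psi p q) $ n) * r ^ n \<le> 1 * r"
      using assms by (intro mult_mono) simp_all
    then show ?thesis by simp
  qed
qed

text \<open>Substituting \<open>p ^ j * T\<close> contracts the radius by \<open>p ^ j\<close>,
  while the prefactor \<open>1 / p ^ j\<close> has absolute value \<open>p ^ j\<close>.\<close>

lemma gauss_le_Psi_term:
  assumes C: "gauss_le (R / real p ^ j) C (lift_fps (Psi p q))" and R: "0 < R"
  shows "gauss_le R (real p ^ j * C ^ (q ^ j)) (Psi_term p q j)"
proof -
  have "gauss_le R (absv (1 / of_nat p ^ j) * C ^ (q ^ j)) (Psi_term p q j)"
    unfolding Psi_term_def using C R
    by (intro gauss_le_const_mult gauss_le_power gauss_le_compose_linear)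
       (simp_all add: absv_power absv_p power_divide)
  then show ?thesis by (simp add: absv_divide absv_power absv_p absv_1 power_divide)
qed

text \<open>For \<open>j > k\<close> the contracted radius is at most \<open>1 / p\<close>, and
  there the Gauss norm of the series is at most the radius. Since \<open>q ^ j \<ge> j + 1\<close>,
  the power \<open>q ^ j\<close> outweighs the prefactor \<open>p ^ j\<close> and leaves a factor
  \<open>1 / p\<close>.\<close>

lemma gauss_le_Psi_term_small:
  assumes "k < j"
  shows "gauss_le (real p ^ k) (1 / real p) (Psi_term p q j)"
proof -
  let ?r = "real p ^ k / real p ^ j"
  have "real p ^ Suc k \<le> real p ^ j"
    using assms p by (intro power_increasing) auto
  then have r: "?r \<le> 1 / real p" using p by (simp add: field_simps)
  have "gauss_le ?r ?r (lift_fps (Psi p q))"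
  proof (rule gauss_le_Psi_unit_disc)
    have "1 / real p \<le> 1" using p by simp
    then show "?r \<le> 1" using r by linarith
  qed simp
  from gauss_le_Psi_term[OF this]
  have G: "gauss_le (real p ^ k) (real p ^ j * ?r ^ (q ^ j)) (Psi_term p q j)"
    using p by simp
  have "Suc j \<le> 2 ^ j" by (simp add: Suc_le_eq)
  also have "\<dots> \<le> q ^ j" using q by (intro power_mono) auto
  finally have j: "Suc j \<le> q ^ j" .
  have "real p ^ j * ?r ^ (q ^ j) \<le> real p ^ j * (1 / real p) ^ (q ^ j)"
    using r by (intro mult_left_mono power_mono) auto
  also have "\<dots> \<le> real p ^ j * (1 / real p) ^ Suc j"
    using p j by (intro mult_left_mono power_decreasing) auto
  also have "\<dots> = 1 / real p" using p by (simp add: power_divide)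
  finally show ?thesis using G unfolding gauss_le_def by (blast intro: order_trans)
qed

text \<open>The functional equation expresses \<open>\<Psi>\<^sub>q\<close> on the disc of radius \<open>p\<^sup>k\<^sup>+\<^sup>1\<close> through its values on
  the disc of radius \<open>p\<^sup>k\<close>.\<close>

lemma gauss_le_Psi_ex: "\<exists>C. gauss_le (real p ^ k) C (lift_fps (Psi p q))"
proof (induction k)
  case 0
  show ?case using gauss_le_Psi_unit_disc[of 1] by auto
next
  case (Suc k)
  let ?P = "lift_fps (Psi p q)" and ?R = "real p ^ Suc k"
  obtain C0 where C0: "gauss_le (real p ^ k) C0 ?P" using Suc by blast
  \<comment> \<open>With \<open>C \<ge> 1\<close> the powers \<open>C ^ (q ^ j)\<close> grow with
    \<open>j\<close>, so the one for \<open>j = Suc k\<close> bounds all earlier ones.\<close>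
  define C where "C = max 1 C0"
  have C: "gauss_le (real p ^ k) C ?P" "C \<ge> 1"
    using C0 by (auto simp: C_def gauss_le_def le_max_iff_disj)
  have R: "?R \<ge> 1" using p by (intro one_le_power) simp
  \<comment> \<open>\<open>D\<close> dominates the Gauss norm \<open>?R\<close> of \<open>T\<close>
    and the bounds for the terms with \<open>1 \<le> j \<le> Suc k\<close> and with
    \<open>j > Suc k\<close>.\<close>
  define D where "D = ?R * C ^ (q ^ Suc k) + ?R"
  have D: "?R \<le> D" "?R * C ^ (q ^ Suc k) \<le> D" "1 / real p \<le> D"
  proof -
    have "0 \<le> ?R * C ^ (q ^ Suc k)" using C(2) R by (intro mult_nonneg_nonneg zero_le_power) auto
    then show "?R \<le> D" "?R * C ^ (q ^ Suc k) \<le> D" using R by (simp_all only: D_def)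
    have "1 / real p \<le> 1" using p by simp
    then show "1 / real p \<le> D" using R \<open>?R \<le> D\<close> by linarith
  qed
  have terms: "absv (Psi_term p q j $ n) * ?R ^ n \<le> D" if "j \<ge> 1" for j n
  proof (cases "Suc k < j")
    case True
    then show ?thesis
      using gauss_leD[OF gauss_le_Psi_term_small[OF True], of n] D(3) by linarith
  next
    case False
    \<comment> \<open>As \<open>j \<ge> 1\<close>, the contracted radius is at most
      \<open>p ^ k\<close>, where the induction hypothesis applies.\<close>
    have "real p ^ Suc k \<le> real p ^ (k + j)"
      using that p by (intro power_increasing) auto
    then have "?R / real p ^ j \<le> real p ^ k" using p by (simp add: field_simps power_add)
    then have "gauss_le (?R / real p ^ j) C ?P"
      by (intro gauss_le_mono_radius[OF C(1)]) simp_all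
    then have "absv (Psi_term p q j $ n) * ?R ^ n \<le> real p ^ j * C ^ (q ^ j)"
      by (intro gauss_leD gauss_le_Psi_term) (use p in simp_all)
    also have "\<dots> \<le> ?R * C ^ (q ^ Suc k)"
      using False p q C(2) by (intro mult_mono power_increasing) auto
    finally show ?thesis using D(2) by linarith
  qed
  have "gauss_le ?R D ?P"
    unfolding gauss_le_def
  proof
    fix n
    obtain M where M: "M \<ge> 1" "(\<Sum>j<M. Psi_term p q j $ n) = fps_X $ n"
      by (rule Psi_term_sum)
    have "{..<M} = insert 0 {1..<M}" using M(1) by auto
    moreover have "Psi_term p q 0 = ?P" by (simp add: Psi_term_def)
    ultimately have "fps_X $ n = ?P $ n + (\<Sum>j=1..<M. Psi_term p q j $ n)"
      using M(2) by simp
    then have "?P $ n = fps_X $ n - (\<Sum>j=1..<M. Psi_term p q j $ n)"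
      by (simp only: add_diff_cancel_right')
    also have "absv \<dots> \<le> D / ?R ^ n"
    proof (rule absv_diff_le)
      show "absv (fps_X $ n) \<le> D / ?R ^ n"
        using D(1) R by (cases "n = 1") (simp_all add: fps_X_def absv_1 field_simps)
      show "absv (\<Sum>j=1..<M. Psi_term p q j $ n) \<le> D / ?R ^ n"
      proof (rule absv_sum_le)
        show "0 \<le> D / ?R ^ n" using D(1) R by simp
        fix j assume "j \<in> {1..<M}"
        then show "absv (Psi_term p q j $ n) \<le> D / ?R ^ n"
          using terms[of j n] p by (subst pos_le_divide_eq) auto
      qed
    qed
    finally show "absv (?P $ n) * ?R ^ n \<le> D" using p by (subst (asm) pos_le_divide_eq) auto
  qed
  then show ?case by blast
qed

section \<open>Existence and integrality of the values\<close>

lemma Psi_evals_ex: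
  assumes mcomplete
  shows "\<exists>s. evals (lift_fps (Psi p q)) a s"
proof -
  obtain k where k: "absv a < real p ^ k"
    using real_arch_pow[of "real p" "absv a"] p by auto
  then show ?thesis
    using gauss_le_Psi_ex[of k] evals_exists_if_gauss_le[OF assms] by blast
qed

text \<open>The functional equation cut off at \<open>N > k\<close> holds modulo \<open>p\<close> on
  the disc of radius \<open>p ^ k\<close>: the omitted terms have Gauss norm at most
  \<open>1 / p\<close>, and this bounds the value of the remainder. Only a finite sum of series is
  ever evaluated.\<close>

lemma Psi_equation_approx:
  assumes a: "absv a \<le> real p ^ k" and N: "k < N"
    and x: "\<And>j. evals (lift_fps (Psi p q)) (of_nat p ^ j * a) (x j)"
  shows "absv (a - (\<Sum>j<N. x j ^ (q ^ j) / of_nat p ^ j)) \<le> 1 / real p"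
proof (rule evals_gauss_le[OF _ _ a])
  have "evals (Psi_term p q j) a (x j ^ (q ^ j) / of_nat p ^ j)" for j
    using evals_mult[OF evals_const[of "1 / of_nat p ^ j" a]
        evals_power[OF evals_compose_linear[OF x[of j]], of "q ^ j"]]
    by (simp add: Psi_term_def)
  then show "evals (fps_X - (\<Sum>j<N. Psi_term p q j)) a (a - (\<Sum>j<N. x j ^ (q ^ j) / of_nat p ^ j))"
    by (intro evals_diff evals_X evals_sum)
  show "gauss_le (real p ^ k) (1 / real p) (fps_X - (\<Sum>j<N. Psi_term p q j))"
    unfolding gauss_le_def
  proof
    fix n
    \<comment> \<open>Each coefficient of the remainder is a finite sum of omitted terms, with an
      upper end \<open>M\<close> that may vary with \<open>n\<close>.\<close>
    obtain M where M: "M \<ge> N" "(\<Sum>j<M. Psi_term p q j $ n) = fps_X $ n"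
      by (rule Psi_term_sum)
    have "(fps_X - (\<Sum>j<N. Psi_term p q j)) $ n = (\<Sum>j=N..<M. Psi_term p q j $ n)"
      using sum_diff_nat_ivl[of 0 N M "\<lambda>j. Psi_term p q j $ n"] M
      by (simp add: fps_sum_nth atLeast0LessThan)
    also have "absv \<dots> \<le> 1 / real p / (real p ^ k) ^ n"
    proof (rule absv_sum_le)
      fix j assume "j \<in> {N..<M}"
      then have "absv (Psi_term p q j $ n) * (real p ^ k) ^ n \<le> 1 / real p"
        using N by (intro gauss_leD gauss_le_Psi_term_small) auto
      then show "absv (Psi_term p q j $ n) \<le> 1 / real p / (real p ^ k) ^ n"
        using p by (subst pos_le_divide_eq) auto
    qed simp
    finally show "absv ((fps_X - (\<Sum>j<N. Psi_term p q j)) $ n) * (real p ^ k) ^ n \<le> 1 / real p"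
      using p by (subst (asm) pos_le_divide_eq) auto
  qed
qed

text \<open>In \<open>u ^ q - v ^ q = (u - v) * ?S\<close>, replacing every \<open>u ^ i\<close> in
  \<open>?S\<close> by \<open>v ^ i\<close> costs at most \<open>1 / p\<close> and leaves
  \<open>q * v ^ (q - 1)\<close>, which is small because \<open>q\<close> is.\<close>

lemma absv_power_q_diff_le:
  assumes q_small: "absv (of_nat q) \<le> 1 / real p"
    and u: "absv u \<le> 1" and v: "absv v \<le> 1" and uv: "absv (u - v) \<le> 1 / real p"
  shows "absv (u ^ q - v ^ q) \<le> absv (u - v) / real p"
proof -
  let ?S = "\<Sum>i<q. v ^ (q - Suc i) * u ^ i"
  have S: "?S = (\<Sum>i<q. v ^ (q - Suc i) * (u ^ i - v ^ i)) + of_nat q * v ^ (q - 1)"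
  proof -
    have "of_nat q * v ^ (q - 1) = (\<Sum>i<q. v ^ (q - Suc i) * v ^ i)"
      by (simp flip: power_add)
    then show ?thesis by (simp add: algebra_simps sum_subtractf)
  qed
  have vk: "absv (v ^ k) \<le> 1" for k using v by (simp add: absv_power power_le_one absv_nonneg)
  have "absv ?S \<le> 1 / real p"
    unfolding S
  proof (intro absv_add_le absv_sum_le)
    fix i
    show "absv (v ^ (q - Suc i) * (u ^ i - v ^ i)) \<le> 1 / real p"
      using mult_mono[OF vk[of "q - Suc i"] order_trans[OF absv_power_diff_le[OF u v, of i] uv]]
      by (simp add: absv_mult absv_nonneg)
    show "absv (of_nat q * v ^ (q - 1)) \<le> 1 / real p"
      using mult_mono[OF q_small vk[of "q - 1"]] by (simp add: absv_mult absv_nonneg)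
  qed simp
  moreover have "u ^ q - v ^ q = (u - v) * ?S"
    by (rule power_diff_sumr2)
  ultimately show ?thesis
    using mult_left_mono[of "absv ?S" "1 / real p" "absv (u - v)"]
    by (simp add: absv_mult absv_nonneg)
qed

text \<open>Starting from \<open>x ^ q \<equiv> x\<close> modulo \<open>p\<close>, each further
  \<open>q\<close>-th power gains one factor \<open>1 / p\<close>. This pays for the denominators
  \<open>p ^ Suc j\<close> in \<open>Psi_evals_integral\<close>.\<close>

lemma absv_iterated_power_q_diff_le:
  assumes "absv (of_nat q) \<le> 1 / real p" "absv x \<le> 1" "absv (x ^ q - x) \<le> 1 / real p"
  shows "absv (x ^ (q ^ Suc j) - x ^ (q ^ j)) \<le> 1 / real p ^ Suc j"
proof (induction j)
  case 0
  show ?case using assms by simp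
next
  case (Suc j)
  let ?u = "x ^ (q ^ Suc j)" and ?v = "x ^ (q ^ j)"
  have xk: "absv (x ^ k) \<le> 1" for k using assms by (simp add: absv_power power_le_one absv_nonneg)
  have "(1::real) \<le> real p ^ j" using p by (intro one_le_power) simp
  then have "1 / real p ^ Suc j \<le> 1 / real p" using p by (simp add: field_simps)
  then have "absv (?u ^ q - ?v ^ q) \<le> absv (?u - ?v) / real p"
    using Suc by (intro absv_power_q_diff_le assms xk) linarith
  also have "\<dots> \<le> 1 / real p ^ Suc j / real p"
    using p by (intro divide_right_mono Suc) simp
  finally show ?case by (simp flip: power_mult add: mult_ac)
qed

text \<open>Comparing the functional equation at \<open>a\<close> with \<open>1 / p\<close> times the one at \<open>p a\<close> cancels \<open>a\<close> and
  writes \<open>\<Psi>\<^sub>q(a)\<close> as the sum of the \<open>p\<^sup>-\<^sup>j (x\<^sub>j\<^bsup>q^(j-1)\<^esup> - x\<^sub>j\<^bsup>q^j\<^esup>)\<close> with \<open>j \<ge> 1\<close>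
  and \<open>x\<^sub>j = \<Psi>\<^sub>q(p\<^sup>j a)\<close>, whose terms are integral because \<open>x\<^sub>j\<^sup>q \<equiv> x\<^sub>j\<close> modulo \<open>p\<close>.\<close>

lemma Psi_evals_integral:
  assumes complete: mcomplete
    and q_small: "absv (of_nat q) \<le> 1 / real p"
    and frob: "\<And>x. absv x \<le> 1 \<Longrightarrow> absv (x ^ q - x) \<le> 1 / real p"
    and s: "evals (lift_fps (Psi p q)) a s"
  shows "absv s \<le> 1"
proof -
  obtain k where "absv a < real p ^ k"
    using real_arch_pow[of "real p" "absv a"] p by auto
  then have "absv a \<le> real p ^ k" by simp
  then show ?thesis using s
  proof (induction k arbitrary: a s)
    case 0
    then show ?case using evals_gauss_le[OF _ gauss_le_Psi_unit_disc[of 1]] by simp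
  next
    case (Suc k)
    have "\<forall>j. \<exists>x. evals (lift_fps (Psi p q)) (of_nat p ^ j * a) x"
      using Psi_evals_ex[OF complete] by blast
    then obtain x where x: "\<And>j. evals (lift_fps (Psi p q)) (of_nat p ^ j * a) (x j)"
      by metis
    have s: "s = x 0" using evals_unique[OF Suc.prems(2)] x[of 0] by simp
    have absv_pj: "absv (of_nat p ^ Suc j * a) \<le> real p ^ k" for j
    proof -
      have "absv (of_nat p ^ Suc j * a) = absv a / real p ^ Suc j"
        by (simp add: absv_mult absv_power absv_p power_divide)
      also have "\<dots> \<le> real p ^ Suc k / real p ^ Suc j"
        using Suc.prems by (intro divide_right_mono) auto
      also have "\<dots> \<le> real p ^ Suc k / real p ^ 1"
        using p by (intro divide_left_mono power_increasing) auto
      finally show ?thesis using p by simp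
    qed
    have xj: "absv (x (Suc j)) \<le> 1" for j
      by (rule Suc.IH[OF absv_pj x])
    let ?P = "of_nat p :: 'a"
    have P0: "?P \<noteq> 0" using p by simp
    \<comment> \<open>Large enough to cut off both equations: \<open>Suc k < Suc N\<close> at
      \<open>a\<close> and \<open>k < N\<close> at \<open>p * a\<close>.\<close>
    define N where "N = Suc (Suc k)"
    \<comment> \<open>\<open>E\<close> and \<open>E'\<close> are the errors of the two truncated
      equations. The one at \<open>a\<close> keeps an extra term because its summand
      \<open>j = 0\<close> is \<open>s\<close> itself; division by \<open>p\<close> then matches
      index \<open>j\<close> at \<open>p * a\<close> with \<open>Suc j\<close> at
      \<open>a\<close>.\<close>
    define E where "E = a - (\<Sum>j<Suc N. x j ^ (q ^ j) / ?P ^ j)"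
    define E' where "E' = ?P * a - (\<Sum>j<N. x (Suc j) ^ (q ^ j) / ?P ^ j)"
    have E: "absv E \<le> 1 / real p"
      unfolding E_def by (rule Psi_equation_approx[OF Suc.prems(1) _ x]) (simp add: N_def)
    have E': "absv E' \<le> 1 / real p"
      unfolding E'_def
    proof (rule Psi_equation_approx)
      show "absv (?P * a) \<le> real p ^ k" using absv_pj[of 0] by simp
      show "evals (lift_fps (Psi p q)) (?P ^ j * (?P * a)) (x (Suc j))" for j
        using x[of "Suc j"] by (simp add: mult_ac)
    qed (simp add: N_def)
    have "s = (\<Sum>j<N. (x (Suc j) ^ (q ^ j) - x (Suc j) ^ (q ^ Suc j)) / ?P ^ Suc j) + (E' / ?P - E)"
    proof -
      have "E = a - (x 0 + (\<Sum>j<N. x (Suc j) ^ (q ^ Suc j) / ?P ^ Suc j))"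
        unfolding E_def sum.lessThan_Suc_shift by simp
      moreover have "E' / ?P = a - (\<Sum>j<N. x (Suc j) ^ (q ^ j) / ?P ^ Suc j)"
        using P0 by (simp add: E'_def diff_divide_distrib sum_divide_distrib mult_ac)
      ultimately show ?thesis
        by (simp add: s diff_divide_distrib sum_subtractf)
    qed
    also have "absv \<dots> \<le> 1"
    proof (intro absv_add_le absv_sum_le absv_diff_le)
      fix j
      have "absv (x (Suc j) ^ (q ^ j) - x (Suc j) ^ (q ^ Suc j)) \<le> 1 / real p ^ Suc j"
        using absv_iterated_power_q_diff_le[OF q_small xj frob[OF xj], of j j]
        by (simp add: absv_minus_commute)
      then show "absv ((x (Suc j) ^ (q ^ j) - x (Suc j) ^ (q ^ Suc j)) / ?P ^ Suc j) \<le> 1"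
        using p unfolding absv_divide absv_power[of ?P] absv_p by (simp add: power_divide field_simps)
      \<comment> \<open>The error bound \<open>1 / p\<close>, rather than 1, absorbs this division
        by \<open>p\<close>.\<close>
      show "absv (E' / ?P) \<le> 1"
        using E' p by (simp add: absv_divide absv_p field_simps)
      show "absv E \<le> 1" using E p by (auto intro: order_trans)
    qed simp
    finally show ?case .
  qed
qed

end

end

section \<open>The residue field\<close>

context nonarch_field
begin

section \<open>Congruences modulo the maximal ideal\<close>

text \<open>Telescoping changes one factor at a time, and the other factors are integral. It serves
  to compare products over all nonzero residues in \<open>frobenius_congruence\<close>.\<close>

lemma absv_prod_diff_less_1:
  assumes "finite A" "\<And>i. i \<in> A \<Longrightarrow> absv (u i) \<le> 1" "\<And>i. i \<in> A \<Longrightarrow> absv (v i) \<le> 1"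
    "\<And>i. i \<in> A \<Longrightarrow> absv (u i - v i) < 1"
  shows "absv (prod u A - prod v A) < 1"
  using assms
proof (induction A rule: finite_induct)
  case (insert x A)
  have eq: "prod u (insert x A) - prod v (insert x A)
      = u x * (prod u A - prod v A) + (u x - v x) * prod v A"
    using insert.hyps by (simp add: algebra_simps)
  have "absv (u x * (prod u A - prod v A)) \<le> 1 * absv (prod u A - prod v A)"
    unfolding absv_mult using insert.prems by (intro mult_right_mono absv_nonneg) auto
  also have "\<dots> < 1" using insert by simp
  finally have 1: "absv (u x * (prod u A - prod v A)) < 1" .
  have "absv (prod v A) \<le> 1"
    unfolding absv_prod using insert.prems by (intro prod_le_1) (auto simp: absv_nonneg)
  then have "absv ((u x - v x) * prod v A) \<le> absv (u x - v x) * 1"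
    unfolding absv_mult by (intro mult_left_mono absv_nonneg)
  also have "\<dots> < 1" using insert.prems by simp
  finally have "absv ((u x - v x) * prod v A) < 1" .
  with 1 show ?case
    unfolding eq using absv_add_le_max by (smt (verit))
qed simp

text \<open>If \<open>p\<close> does not divide \<open>u\<close>, a Bezout relation
  \<open>p * v + u * w = 1\<close> would give 1 an absolute value below 1.\<close>

lemma absv_of_int_less_1_iff:
  assumes p: "prime p" and absv_p: "absv (of_nat p) < 1"
  shows "absv (of_int u) < 1 \<longleftrightarrow> int p dvd u"
proof
  assume "int p dvd u"
  then obtain w where "u = int p * w" by (auto elim: dvdE)
  then have "absv (of_int u) = absv (of_nat p) * absv (of_int w)" by (simp add: absv_mult)
  also have "\<dots> \<le> absv (of_nat p) * 1" by (intro mult_left_mono absv_of_int_le_1 absv_nonneg)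
  finally show "absv (of_int u) < 1" using absv_p by simp
next
  assume u: "absv (of_int u) < 1"
  show "int p dvd u"
  proof (rule ccontr)
    assume "\<not> int p dvd u"
    then have "coprime (int p) u" using p by (intro prime_imp_coprime) auto
    then obtain v w where "int p * v + u * w = 1"
      using bezout_int[of "int p" u] by (auto simp: mult.commute)
    then have "of_int (int p * v + u * w) = (1 :: 'a)" by (simp only: of_int_1)
    then have eq: "(1 :: 'a) = of_nat p * of_int v + of_int u * of_int w" by simp
    have "absv (of_nat p * of_int v) \<le> absv (of_nat p) * 1"
      unfolding absv_mult by (intro mult_left_mono absv_of_int_le_1 absv_nonneg)
    moreover have "absv (of_int u * of_int w) \<le> absv (of_int u) * 1"
      unfolding absv_mult by (intro mult_left_mono absv_of_int_le_1 absv_nonneg)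
    ultimately have "absv (of_nat p * of_int v + of_int u * of_int w) < 1"
      using absv_add_le_max absv_p u by (smt (verit))
    then show False using eq absv_1 by simp
  qed
qed

end

context padic_numbers
begin

section \<open>Residue field and value group of the \<open>p\<close>-adic numbers\<close>

lemma absv_of_p: "absv (of_nat p) = 1 / real p"
proof -
  have "padic_abs p (of_nat p) = 1 / real p"
    using prime_p quotient_of_int[of "int p"] prime_gt_1_nat[OF prime_p]
    by (simp add: padic_abs_def multiplicity_self power_int_minus field_simps)
  then show ?thesis using absv_of_rat[of "of_nat p"] by simp
qed

lemma absv_of_p_less_1: "absv (of_nat p) < 1"
  using prime_gt_1_nat[OF prime_p] by (simp add: absv_of_p)

lemma ex_rat_close:
  assumes "e > 0"
  shows "\<exists>r. absv (x - of_rat r) < e"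
proof -
  have "x \<in> mtopology closure_of (range of_rat)" using dense_rat by simp
  then show ?thesis using assms by (auto simp: metric_closure_of mball_def)
qed

text \<open>By density \<open>x\<close> is close to a fraction \<open>m / n\<close> in lowest terms.
  Integrality forces \<open>p\<close> not to divide \<open>n\<close>, and with \<open>v\<close>
  inverse to \<open>n\<close> modulo \<open>p\<close> the integer \<open>m * v\<close> is congruent
  to \<open>m / n\<close>.\<close>

lemma ex_int_close:
  assumes x: "absv x \<le> 1"
  shows "\<exists>u. absv (x - of_int u) < 1"
proof -
  obtain r where r: "absv (x - of_rat r) < 1" using ex_rat_close[of 1] by auto
  have r1: "absv (of_rat r) \<le> 1"
    using absv_diff_le[of x 1 "x - of_rat r"] r x by simp
  obtain m n where mn: "r = Fract m n" "n > 0" "coprime m n" by (cases r)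
  have r_eq: "of_rat r = (of_int m / of_int n :: 'k)"
    using mn by (simp add: Fract_of_int_quotient of_rat_divide)
  note iff = absv_of_int_less_1_iff[OF prime_p absv_of_p_less_1]
  have "\<not> int p dvd n"
  proof
    assume n: "int p dvd n"
    then have "\<not> int p dvd m" 
      using mn(3) prime_p by (meson not_prime_unit coprime_common_divisor prime_nat_int_transfer)
    then have "absv (of_int m) = 1" "absv (of_int n) < 1"
      using iff[of m] iff[of n] n absv_of_int_le_1[of m] by auto
    moreover have "absv (of_int n) > 0"
      using mn(2) absv_nonneg[of "of_int n"] absv_eq_0_iff[of "of_int n"] by simp
    ultimately show False using r1 by (simp add: r_eq absv_divide field_simps)
  qed
  then have "coprime n (int p)" using prime_p by (metis coprime_commute prime_imp_coprime prime_nat_int_transfer)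
  then obtain v w where vw: "v * n + w * int p = 1"
    using bezout_int[of n "int p"] by auto
  have n1: "absv (of_int n) = 1"
    using iff[of n] \<open>\<not> int p dvd n\<close> absv_of_int_le_1[of n] by auto
  have "of_rat r - of_int (m * v) = (of_int (m * (1 - v * n)) / of_int n :: 'k)"
    using mn(2) by (simp add: r_eq field_simps)
  also have "1 - v * n = w * int p" using vw by simp
  finally have "absv (of_rat r - of_int (m * v)) = absv (of_int (m * (w * int p)))"
    by (simp add: absv_divide n1)
  also have "\<dots> < 1" by (subst iff) simp
  finally have "absv ((x - of_rat r) + (of_rat r - of_int (m * v))) < 1"
    using r absv_add_le_max by (smt (verit))
  then have "absv (x - of_int (m * v)) < 1" by simp
  then show ?thesis by (rule exI)
qed

text \<open>By density and the isosceles principle \<open>x\<close> has the absolute value of a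
  nonzero rational.\<close>

lemma absv_eq_powi:
  assumes "x \<noteq> 0"
  shows "\<exists>k. absv x = real p powi k"
proof -
  have "absv x > 0" using assms absv_eq_0_iff absv_nonneg[of x] by (simp add: less_le)
  then obtain r where r: "absv (x - of_rat r) < absv x" using ex_rat_close by blast
  then have "absv (of_rat r) = absv x"
    using absv_eq_of_diff_less[of "of_rat r" x] by (simp add: absv_minus_commute)
  moreover have "r \<noteq> 0" using r by auto
  ultimately show ?thesis
    by (metis (no_types, lifting) absv_of_rat padic_abs_def case_prod_beta)
qed

end

context unramified_padic_extension
begin

section \<open>The embedding and the value group of the extension\<close>

lemma emb_0 [simp]: "emb 0 = 0"
  using emb_add[of 0 0] by simp

lemma emb_minus: "emb (- x) = - emb x"
  using emb_add[of x "- x"] by (simp add: eq_neg_iff_add_eq_0 add.commute)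

lemma emb_diff: "emb (x - y) = emb x - emb y"
  using emb_add[of x "- y"] by (simp add: emb_minus)

lemma emb_of_nat: "emb (of_nat n) = of_nat n"
  by (induction n) (simp_all add: emb_add emb_1)

lemma emb_of_int: "emb (of_int n) = of_int n"
  by (cases n) (simp_all only: of_int_of_nat_eq of_int_minus emb_minus emb_of_nat)

lemma p_gt_1: "1 < p"
  by (rule prime_gt_1_nat[OF Qp.prime_p])

lemma absq_p: "absq (of_nat p) = 1 / real p"
  using absq_emb[of "of_nat p"] by (simp add: emb_of_nat Qp.absv_of_p)

lemma absq_of_int_less_1_iff: "absq (of_int u) < 1 \<longleftrightarrow> int p dvd u"
  by (rule Qq.absv_of_int_less_1_iff[OF Qp.prime_p]) (use p_gt_1 in \<open>simp add: absq_p\<close>)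

lemma absq_eq_powi:
  assumes "x \<noteq> 0"
  shows "\<exists>k. absq x = real p powi k"
proof -
  obtain y where "y \<noteq> 0" "absq x = absp y" using assms unramified by blast
  then show ?thesis using Qp.absv_eq_powi[of y] by simp
qed

text \<open>Ramification index 1 enters here: the nonzero absolute values are powers of
  \<open>p\<close>, so none lies strictly between \<open>1 / p\<close> and 1, and \<open>p\<close>
  generates the maximal ideal.\<close>

lemma absq_le_if_less_1:
  assumes "absq x < 1"
  shows "absq x \<le> 1 / real p"
proof (cases "x = 0")
  case False
  then obtain k where k: "absq x = real p powi k" using absq_eq_powi by blast
  have "k < 0"
  proof (rule ccontr)
    assume "\<not> k < 0"
    then have "1 \<le> real p powi k" using p_gt_1 by (intro one_le_power_int) auto
    then show False using assms k by simp
  qed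
  then have "real p powi k \<le> real p powi (-1)" using p_gt_1 by (intro power_int_increasing) auto
  then show ?thesis by (simp add: k power_int_minus field_simps)
qed simp

section \<open>Residue independence and orthonormality\<close>

text \<open>The residue classes of \<open>B\<close> are linearly independent over the field with
  \<open>p\<close> elements; integers stand for the scalars and \<open>absq\<close> below 1 for
  vanishing of the class.\<close>

definition residue_indep :: "'a set \<Rightarrow> bool" where
  "residue_indep B \<longleftrightarrow> finite B \<and> (\<forall>b\<in>B. absq b \<le> 1) \<and>
     (\<forall>u. absq (\<Sum>b\<in>B. of_int (u b) * b) < 1 \<longrightarrow> (\<forall>b\<in>B. int p dvd u b))"

lemma absq_lincomb_le:
  assumes B: "residue_indep B" and C: "0 \<le> C" "\<And>b. b \<in> B \<Longrightarrow> absp (\<alpha> b) \<le> C"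
  shows "absq (\<Sum>b\<in>B. emb (\<alpha> b) * b) \<le> C"
proof (rule Qq.absv_sum_le[OF C(1)])
  fix b assume "b \<in> B"
  then have "absp (\<alpha> b) * absq b \<le> C * 1"
    using B C by (intro mult_mono) (auto simp: residue_indep_def Qq.absv_nonneg)
  then show "absq (emb (\<alpha> b) * b) \<le> C" by (simp add: Qq.absv_mult absq_emb)
qed

text \<open>With \<open>absq_lincomb_le\<close> this is orthonormality. Dividing by a largest
  coefficient \<open>\<alpha> c\<close> makes all coefficients integral, hence congruent to integers
  \<open>u b\<close>. Were the normalized combination small, \<open>p\<close> would divide
  \<open>u c\<close>, although \<open>u c\<close> is congruent to
  \<open>\<beta> c = 1\<close>.\<close>

lemma absp_le_absq_lincomb:
  assumes B: "residue_indep B" and b: "b \<in> B"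
  shows "absp (\<alpha> b) \<le> absq (\<Sum>b\<in>B. emb (\<alpha> b) * b)"
proof -
  have fin: "finite B" using B by (simp add: residue_indep_def)
  have "Max ((\<lambda>b. absp (\<alpha> b)) ` B) \<in> (\<lambda>b. absp (\<alpha> b)) ` B"
    using fin b by (intro Max_in) auto
  then obtain c where c: "c \<in> B" "absp (\<alpha> c) = Max ((\<lambda>b. absp (\<alpha> b)) ` B)" by fastforce
  have max: "absp (\<alpha> b) \<le> absp (\<alpha> c)" if "b \<in> B" for b
    unfolding c(2) using fin that by (intro Max_ge) auto
  show ?thesis
  proof (cases "\<alpha> c = 0")
    case True
    then have "absp (\<alpha> b) \<le> 0" using max[OF b] by simp
    then show ?thesis using Qq.absv_nonneg by (rule order_trans)
  next
    case False
    then have c0: "0 < absp (\<alpha> c)"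
      using Qp.absv_eq_0_iff Qp.absv_nonneg[of "\<alpha> c"] by (simp add: less_le)
    define \<beta> where "\<beta> b = \<alpha> b / \<alpha> c" for b
    have \<beta>1: "absp (\<beta> b) \<le> 1" if "b \<in> B" for b
      using max[OF that] c0 by (simp add: \<beta>_def Qp.absv_divide)
    have "\<forall>b. \<exists>u. b \<in> B \<longrightarrow> absp (\<beta> b - of_int u) < 1"
      using Qp.ex_int_close[OF \<beta>1] by blast
    then obtain u where u: "\<And>b. b \<in> B \<Longrightarrow> absp (\<beta> b - of_int (u b)) < 1" by metis
    have "\<not> absq (\<Sum>b\<in>B. emb (\<beta> b) * b) < 1"
    proof
      assume less: "absq (\<Sum>b\<in>B. emb (\<beta> b) * b) < 1"
      \<comment> \<open>The gap in the value group turns the strict bounds into one bound uniform in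
        \<open>b\<close>.\<close>
      have "absp (\<beta> b - of_int (u b)) \<le> 1 / real p" if "b \<in> B" for b
        using absq_le_if_less_1[of "emb (\<beta> b - of_int (u b))"] u[OF that] by (simp add: absq_emb)
      then have "absq (\<Sum>b\<in>B. emb (\<beta> b - of_int (u b)) * b) \<le> 1 / real p"
        by (intro absq_lincomb_le[OF B]) auto
      also have "\<dots> < 1" using p_gt_1 by simp
      finally have less': "absq (\<Sum>b\<in>B. emb (\<beta> b - of_int (u b)) * b) < 1" .
      have "(\<Sum>b\<in>B. of_int (u b) * b)
          = (\<Sum>b\<in>B. emb (\<beta> b) * b) - (\<Sum>b\<in>B. emb (\<beta> b - of_int (u b)) * b)"
        by (simp add: emb_diff emb_of_int left_diff_distrib sum_subtractf)
      then have "absq (\<Sum>b\<in>B. of_int (u b) * b) < 1"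
        using less less' Qq.absv_add_le_max[of "\<Sum>b\<in>B. emb (\<beta> b) * b"
            "- (\<Sum>b\<in>B. emb (\<beta> b - of_int (u b)) * b)"]
        by (simp add: Qq.absv_minus)
      then have "int p dvd u c" using B c(1) by (auto simp: residue_indep_def)
      then have "absp (of_int (u c)) < 1"
        using absq_of_int_less_1_iff[of "u c"] absq_emb[of "of_int (u c)"] by (simp add: emb_of_int)
      moreover have "absp (1 - of_int (u c)) < 1"
        using u[OF c(1)] False by (simp add: \<beta>_def)
      ultimately have "absp ((1 - of_int (u c)) + of_int (u c)) < 1"
        using Qp.absv_add_le_max by (smt (verit))
      then show False by (simp add: Qp.absv_1)
    qed
    then have "absp (\<alpha> c) * 1 \<le> absp (\<alpha> c) * absq (\<Sum>b\<in>B. emb (\<beta> b) * b)"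
      using c0 by (intro mult_left_mono) auto
    also have "\<dots> = absq (\<Sum>b\<in>B. emb (\<alpha> c * \<beta> b) * b)"
      unfolding emb_mult mult.assoc sum_distrib_left[symmetric] by (simp add: Qq.absv_mult absq_emb)
    also have "\<dots> = absq (\<Sum>b\<in>B. emb (\<alpha> b) * b)" using False by (simp add: \<beta>_def)
    finally show ?thesis using max[OF b] by simp
  qed
qed

lemma independent_if_residue_indep:
  assumes "residue_indep B"
  shows "independent B"
proof (rule independent_if_scalars_zero)
  show "finite B" using assms by (simp add: residue_indep_def)
  fix \<alpha> b assume "(\<Sum>b\<in>B. emb (\<alpha> b) * b) = 0" "b \<in> B"
  then have "absp (\<alpha> b) \<le> 0" using absp_le_absq_lincomb[OF assms, of b \<alpha>] by simp
  then show "\<alpha> b = 0" using Qp.absv_nonneg[of "\<alpha> b"] Qp.absv_eq_0_iff by simp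
qed

lemma card_residue_indep_le:
  assumes "residue_indep B"
  shows "card B \<le> f"
proof -
  obtain b where "independent b" "UNIV \<subseteq> span b" "card b = f"
    using basis_exists[of UNIV] degree by metis
  \<comment> \<open>An infinite set has \<open>card\<close> 0, which \<open>f \<ge> 1\<close>
    excludes.\<close>
  moreover from this have "finite b" using f_pos by (metis card.infinite not_one_le_zero)
  ultimately show ?thesis
    using independent_span_bound[OF _ independent_if_residue_indep[OF assms], of b] by auto
qed

section \<open>Residue bases and the residue degree\<close>

definition residue_basis :: "'a set \<Rightarrow> bool" where
  "residue_basis B \<longleftrightarrow> residue_indep B \<and> (\<forall>B'. residue_indep B' \<longrightarrow> card B' \<le> card B)"

lemma residue_basis_ex: "\<exists>B. residue_basis B"
proof -
  have "residue_indep {}" by (simp add: residue_indep_def)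
  then obtain B where "residue_indep B" "\<forall>B'. residue_indep B' \<longrightarrow> card B' \<le> card B"
    using ex_has_greatest_nat[of residue_indep "{}" card "Suc f"] card_residue_indep_le
    by (metis less_Suc_eq_le)
  then show ?thesis by (auto simp: residue_basis_def)
qed

text \<open>An exchange argument: by maximality \<open>insert x B\<close> is dependent, and the
  coefficient of \<open>x\<close> in a relation is prime to \<open>p\<close> because
  \<open>B\<close> is independent. Inverting it modulo \<open>p\<close> solves for
  \<open>x\<close>.\<close>

lemma residue_basis_spans_residues:
  assumes B: "residue_basis B" and x: "absq x \<le> 1"
  shows "\<exists>u. absq (x - (\<Sum>b\<in>B. of_int (u b) * b)) < 1"
proof (cases "x \<in> B")
  \<comment> \<open>For \<open>x \<in> B\<close> inserting \<open>x\<close> does not enlarge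
    \<open>B\<close>, so maximality gives nothing; \<open>x\<close> is its own combination.\<close>
  case True
  have "finite B" using B by (simp add: residue_basis_def residue_indep_def)
  then have "(\<Sum>b\<in>B. of_int (if b = x then 1 else 0) * b) = (\<Sum>b\<in>B. if b = x then x else 0)"
    by (intro sum.cong) auto
  also have "\<dots> = x" using \<open>finite B\<close> True by simp
  finally have "absq (x - (\<Sum>b\<in>B. of_int (if b = x then 1 else 0) * b)) < 1" by simp
  then show ?thesis by (rule exI[where x = "\<lambda>b. if b = x then 1 else 0"])
next
  case False
  have ind: "residue_indep B" and fin: "finite B"
    using B by (auto simp: residue_basis_def residue_indep_def)
  have "\<not> residue_indep (insert x B)"
    using B False fin by (auto simp: residue_basis_def)
  then obtain u c where u: "absq (\<Sum>b\<in>insert x B. of_int (u b) * b) < 1"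
    and c: "c \<in> insert x B" "\<not> int p dvd u c"
    using ind x fin by (auto simp: residue_indep_def)
  define s where "s = (\<Sum>b\<in>B. of_int (u b) * b)"
  have u: "absq (of_int (u x) * x + s) < 1" using u False fin by (simp add: s_def)
  have "\<not> int p dvd u x"
  proof
    assume "int p dvd u x"
    then have "absq (of_int (u x)) < 1" by (simp add: absq_of_int_less_1_iff)
    moreover have "absq (of_int (u x)) * absq x \<le> absq (of_int (u x)) * 1"
      by (intro mult_left_mono x Qq.absv_nonneg)
    ultimately have "absq (of_int (u x) * x) < 1" by (simp add: Qq.absv_mult)
    then have "absq s < 1"
      using u Qq.absv_add_le_max[of "of_int (u x) * x + s" "- (of_int (u x) * x)"]
      by (simp add: Qq.absv_minus)
    then have "\<forall>b\<in>B. int p dvd u b" using ind unfolding residue_indep_def s_def by blast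
    then show False using c \<open>int p dvd u x\<close> by auto
  qed
  then have "coprime (u x) (int p)"
    using Qp.prime_p by (metis coprime_commute prime_imp_coprime prime_nat_int_transfer)
  then obtain v w where vw: "v * u x + w * int p = 1"
    using bezout_int[of "u x" "int p"] by auto
  then have "of_int (v * u x + w * int p) = (1 :: 'a)" by (simp only: of_int_1)
  then have one: "of_int v * of_int (u x) = (1 - of_int (w * int p) :: 'a)"
    by (simp add: eq_diff_eq)
  have sum: "(\<Sum>b\<in>B. of_int (- v * u b) * b) = - (of_int v * s)"
    by (simp add: s_def sum_distrib_left sum_negf mult.assoc)
  have eq: "x - (\<Sum>b\<in>B. of_int (- v * u b) * b)
      = of_int v * (of_int (u x) * x + s) + of_int (w * int p) * x"
  proof -
    have "of_int v * (of_int (u x) * x + s) = (of_int v * of_int (u x)) * x + of_int v * s"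
      by (simp add: algebra_simps)
    also have "\<dots> = x - of_int (w * int p) * x + of_int v * s"
      unfolding one by (simp add: left_diff_distrib)
    finally show ?thesis unfolding sum by (simp add: algebra_simps)
  qed
  have "absq (of_int v * (of_int (u x) * x + s)) \<le> 1 * absq (of_int (u x) * x + s)"
    unfolding Qq.absv_mult by (intro mult_right_mono Qq.absv_of_int_le_1 Qq.absv_nonneg)
  moreover have "absq (of_int (w * int p) * x) \<le> absq (of_int (w * int p)) * 1"
    unfolding Qq.absv_mult by (intro mult_left_mono x Qq.absv_nonneg)
  moreover have "absq (of_int (w * int p)) < 1" by (subst absq_of_int_less_1_iff) simp
  ultimately have "absq (x - (\<Sum>b\<in>B. of_int (- v * u b) * b)) < 1"
    unfolding eq using u Qq.absv_add_le_max by (smt (verit))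
  then show ?thesis by (rule exI[where x = "\<lambda>b. - v * u b"])
qed

lemma lincomb_tendsto:
  assumes B: "residue_indep B"
    and \<alpha>: "\<And>b. b \<in> B \<Longrightarrow> (\<lambda>n. absp (\<alpha> n b - \<beta> b)) \<longlonglongrightarrow> 0"
  shows "(\<lambda>n. absq ((\<Sum>b\<in>B. emb (\<alpha> n b) * b) - (\<Sum>b\<in>B. emb (\<beta> b) * b))) \<longlonglongrightarrow> 0"
proof (rule tendsto_sandwich[OF always_eventually always_eventually tendsto_const])
  have fin: "finite B" using B by (simp add: residue_indep_def)
  show "(\<lambda>n. \<Sum>b\<in>B. absp (\<alpha> n b - \<beta> b)) \<longlonglongrightarrow> 0"
    using tendsto_sum[of B "\<lambda>b n. absp (\<alpha> n b - \<beta> b)" "\<lambda>_. 0"] \<alpha> by simp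
  show "\<forall>n. absq ((\<Sum>b\<in>B. emb (\<alpha> n b) * b) - (\<Sum>b\<in>B. emb (\<beta> b) * b))
      \<le> (\<Sum>b\<in>B. absp (\<alpha> n b - \<beta> b))"
  proof
    fix n
    have "absq (\<Sum>b\<in>B. emb (\<alpha> n b - \<beta> b) * b) \<le> (\<Sum>b\<in>B. absp (\<alpha> n b - \<beta> b))"
      using fin by (intro absq_lincomb_le[OF B] sum_nonneg member_le_sum) (auto simp: Qp.absv_nonneg)
    then show "absq ((\<Sum>b\<in>B. emb (\<alpha> n b) * b) - (\<Sum>b\<in>B. emb (\<beta> b) * b))
        \<le> (\<Sum>b\<in>B. absp (\<alpha> n b - \<beta> b))"
      by (simp add: emb_diff left_diff_distrib sum_subtractf)
  qed
qed (simp add: Qq.absv_nonneg)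

text \<open>A \<open>p\<close>-adic digit expansion along \<open>B\<close>: subtract a combination
  with the same residue, divide by \<open>p\<close> and repeat. Each coordinate is then a
  \<open>p\<close>-adic series, which converges by completeness of the base field.\<close>

lemma residue_basis_spans_integers:
  assumes B: "residue_basis B" and x: "absq x \<le> 1"
  shows "\<exists>\<alpha>. x = (\<Sum>b\<in>B. emb (\<alpha> b) * b)"
proof -
  have ind: "residue_indep B" using B by (simp add: residue_basis_def)
  let ?P = "of_nat p :: 'a"
  have P0: "?P \<noteq> 0" using p_gt_1 by simp
  obtain u where u: "\<And>y. absq y \<le> 1 \<Longrightarrow> absq (y - (\<Sum>b\<in>B. of_int (u y b) * b)) < 1"
    using residue_basis_spans_residues[OF B] by metis
  \<comment> \<open>The division by \<open>p\<close> preserves integrality, since a remainder of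
    absolute value below 1 is at most \<open>1 / p\<close>.\<close>
  define next_digit where "next_digit y = (y - (\<Sum>b\<in>B. of_int (u y b) * b)) / ?P" for y
  define X where "X n = (next_digit ^^ n) x" for n
  have X: "absq (X n) \<le> 1" for n
  proof (induction n)
    case 0
    show ?case using x by (simp add: X_def)
  next
    case (Suc n)
    have "absq (X (Suc n)) = absq (X n - (\<Sum>b\<in>B. of_int (u (X n) b) * b)) * real p"
      by (simp add: X_def next_digit_def Qq.absv_divide absq_p)
    also have "\<dots> \<le> 1 / real p * real p"
      by (intro mult_right_mono absq_le_if_less_1 u Suc) simp
    finally show ?case using p_gt_1 by simp
  qed
  have X_step: "X n = (\<Sum>b\<in>B. of_int (u (X n) b) * b) + ?P * X (Suc n)" for n
    using P0 by (simp add: X_def next_digit_def)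
  define s where "s N b = (\<Sum>n<N. of_int (u (X n) b) * of_nat p ^ n :: 'k)" for N b
  have expand: "x = (\<Sum>b\<in>B. emb (s N b) * b) + ?P ^ N * X N" for N
  proof (induction N)
    case 0
    show ?case by (simp add: s_def X_def)
  next
    case (Suc N)
    have "(\<Sum>b\<in>B. emb (s (Suc N) b) * b)
        = (\<Sum>b\<in>B. emb (s N b) * b) + ?P ^ N * (\<Sum>b\<in>B. of_int (u (X N) b) * b)"
    proof -
      have "emb (s (Suc N) b) * b = emb (s N b) * b + ?P ^ N * (of_int (u (X N) b) * b)" for b
      proof -
        have "emb (of_nat p ^ N) = ?P ^ N" using emb_of_nat[of "p ^ N"] by simp
        then show ?thesis by (simp add: s_def emb_add emb_mult emb_of_int algebra_simps)
      qed
      then show ?thesis by (simp add: sum.distrib sum_distrib_left)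
    qed
    moreover have "?P ^ N * X N = ?P ^ N * (\<Sum>b\<in>B. of_int (u (X N) b) * b) + ?P ^ Suc N * X (Suc N)"
      by (subst X_step) (simp add: distrib_left mult_ac)
    ultimately show ?case using Suc by simp
  qed
  have p_pow: "(\<lambda>n. (1 / real p) ^ n) \<longlonglongrightarrow> 0"
    using p_gt_1 by (intro LIMSEQ_power_zero) simp
  have "\<exists>l. (\<lambda>N. absp (s N b - l)) \<longlonglongrightarrow> 0" for b
  proof -
    have "(\<lambda>n. absp (of_int (u (X n) b) * of_nat p ^ n)) \<longlonglongrightarrow> 0"
    proof (rule tendsto_sandwich[OF always_eventually always_eventually tendsto_const p_pow])
      show "\<forall>n. absp (of_int (u (X n) b) * of_nat p ^ n) \<le> (1 / real p) ^ n"
        by (simp add: Qp.absv_mult Qp.absv_power Qp.absv_of_p mult_left_le_one_le Qp.absv_nonneg Qp.absv_of_int_le_1)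
    qed (simp add: Qp.absv_nonneg)
    then have "Qp.MCauchy (\<lambda>N. s N b)" unfolding s_def by (rule Qp.MCauchy_partial_sums)
    then show ?thesis using Qp.complete by (auto simp: Qp.mcomplete_def Qp.limitin_iff_tendsto)
  qed
  then obtain \<alpha> where "\<And>b. (\<lambda>N. absp (s N b - \<alpha> b)) \<longlonglongrightarrow> 0" by metis
  then have lim: "(\<lambda>N. absq ((\<Sum>b\<in>B. emb (s N b) * b) - (\<Sum>b\<in>B. emb (\<alpha> b) * b))) \<longlonglongrightarrow> 0"
    by (intro lincomb_tendsto[OF ind])
  have lim': "(\<lambda>N. absq ((\<Sum>b\<in>B. emb (s N b) * b) - x)) \<longlonglongrightarrow> 0"
  proof (rule tendsto_sandwich[OF always_eventually always_eventually tendsto_const p_pow])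
    show "\<forall>N. absq ((\<Sum>b\<in>B. emb (s N b) * b) - x) \<le> (1 / real p) ^ N"
    proof
      fix N
      have "(\<Sum>b\<in>B. emb (s N b) * b) - x = - (?P ^ N * X N)"
        using expand[of N] by (simp add: algebra_simps)
      then have "absq ((\<Sum>b\<in>B. emb (s N b) * b) - x) = (1 / real p) ^ N * absq (X N)"
        by (simp add: Qq.absv_minus Qq.absv_mult Qq.absv_power absq_p)
      also have "\<dots> \<le> (1 / real p) ^ N" using X by (intro mult_left_le) simp_all
      finally show "absq ((\<Sum>b\<in>B. emb (s N b) * b) - x) \<le> (1 / real p) ^ N" .
    qed
  qed (simp add: Qq.absv_nonneg)
  have "x = (\<Sum>b\<in>B. emb (\<alpha> b) * b)"
    using lim lim' unfolding Qq.limitin_iff_tendsto[symmetric]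
    by (intro Qq.limitin_metric_unique[OF _ _ sequentially_bot])
  then show ?thesis by blast
qed

lemma residue_basis_spans:
  assumes B: "residue_basis B"
  shows "\<exists>\<alpha>. x = (\<Sum>b\<in>B. emb (\<alpha> b) * b)"
proof -
  obtain k where k: "absq x < real p ^ k"
    using real_arch_pow[of "real p" "absq x"] p_gt_1 by auto
  have "absq (of_nat p ^ k * x) \<le> 1"
    using k p_gt_1 by (simp add: Qq.absv_mult Qq.absv_power absq_p field_simps)
  then obtain \<alpha> where \<alpha>: "of_nat p ^ k * x = (\<Sum>b\<in>B. emb (\<alpha> b) * b)"
    using residue_basis_spans_integers[OF B] by blast
  have c: "emb (1 / of_nat p ^ k) * of_nat p ^ k = 1"
    using emb_mult[of "1 / of_nat p ^ k" "of_nat (p ^ k)"] emb_of_nat[of "p ^ k"] p_gt_1 emb_1 by simp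
  have "x = emb (1 / of_nat p ^ k) * (of_nat p ^ k * x)"
    using c by (simp flip: mult.assoc)
  also have "\<dots> = (\<Sum>b\<in>B. emb (1 / of_nat p ^ k * \<alpha> b) * b)"
    unfolding \<alpha> emb_mult by (simp add: sum_distrib_left mult.assoc)
  finally show ?thesis by (rule exI[where x = "\<lambda>b. 1 / of_nat p ^ k * \<alpha> b"])
qed

text \<open>A residue basis is also a basis of the extension over the base field, so the residue
  degree equals the degree, as expected for ramification index 1.\<close>

lemma card_residue_basis:
  assumes B: "residue_basis B"
  shows "card B = f"
proof -
  have "x \<in> span B" for x
  proof -
    obtain \<alpha> where "x = (\<Sum>b\<in>B. emb (\<alpha> b) * b)" using residue_basis_spans[OF B] by blast
    then show ?thesis by (auto intro: span_sum span_scale span_base)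
  qed
  then have "span B = span UNIV" by auto
  moreover have "independent B"
    using B by (simp add: residue_basis_def independent_if_residue_indep)
  ultimately show ?thesis using dim_eq_card degree by metis
qed

text \<open>In an orthonormal basis the coordinates of a Cauchy sequence are Cauchy in the base
  field, and coordinatewise limits give a limit.\<close>

lemma Qq_complete: "Qq.mcomplete"
  unfolding Qq.mcomplete_def
proof (intro allI impI)
  fix \<sigma> assume \<sigma>: "Qq.MCauchy \<sigma>"
  obtain B where B: "residue_basis B" using residue_basis_ex by blast
  then have ind: "residue_indep B" by (simp add: residue_basis_def)
  have "\<forall>n. \<exists>c. \<sigma> n = (\<Sum>b\<in>B. emb (c b) * b)"
    using residue_basis_spans[OF B] by (intro allI)
  from choice[OF this] obtain \<alpha> where \<alpha>: "\<And>n. \<sigma> n = (\<Sum>b\<in>B. emb (\<alpha> n b) * b)"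
    by blast
  have le: "absp (\<alpha> m b - \<alpha> n b) \<le> absq (\<sigma> m - \<sigma> n)" if "b \<in> B" for m n b
    using absp_le_absq_lincomb[OF ind that, of "\<lambda>b. \<alpha> m b - \<alpha> n b"]
    by (simp add: \<alpha> emb_diff left_diff_distrib sum_subtractf)
  have "\<exists>l. b \<in> B \<longrightarrow> (\<lambda>n. absp (\<alpha> n b - l)) \<longlonglongrightarrow> 0" for b
  proof (cases "b \<in> B")
    case True
    have "Qp.MCauchy (\<lambda>n. \<alpha> n b)"
      using \<sigma> le[OF True] unfolding Qp.MCauchy_def Qq.MCauchy_def
      by (meson order_le_less_trans subset_UNIV)
    then show ?thesis using Qp.complete by (auto simp: Qp.mcomplete_def Qp.limitin_iff_tendsto)
  qed simp
  then obtain \<beta> where "\<And>b. b \<in> B \<Longrightarrow> (\<lambda>n. absp (\<alpha> n b - \<beta> b)) \<longlonglongrightarrow> 0" by metis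
  then have "limitin Qq.mtopology \<sigma> (\<Sum>b\<in>B. emb (\<beta> b) * b) sequentially"
    unfolding Qq.limitin_iff_tendsto \<alpha> by (rule lincomb_tendsto[OF ind])
  then show "\<exists>x. limitin Qq.mtopology \<sigma> x sequentially" by (rule exI)
qed

text \<open>Fermat's little theorem in the residue field: its \<open>p\<^sup>f\<close> elements are represented by the
  combinations of a residue basis with coefficients in \<open>{0..<p}\<close>, and multiplication by a unit
  permutes the nonzero ones.\<close>

lemma frobenius_congruence:
  assumes x: "absq x \<le> 1"
  shows "absq (x ^ (p ^ f) - x) \<le> 1 / real p"
proof (rule absq_le_if_less_1, cases "absq x < 1")
  case True
  have "x ^ (p ^ f) - x = x * (x ^ (p ^ f - 1) - 1)"
    using p_gt_1 by (simp add: right_diff_distrib flip: power_Suc)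
  moreover have "absq (x ^ (p ^ f - 1) - 1) \<le> 1"
    using x by (intro Qq.absv_diff_le) (simp_all add: Qq.absv_1 Qq.absv_power power_le_one Qq.absv_nonneg)
  then have "absq x * absq (x ^ (p ^ f - 1) - 1) \<le> absq x * 1"
    by (intro mult_left_mono Qq.absv_nonneg)
  ultimately show "absq (x ^ (p ^ f) - x) < 1" using True by (simp add: Qq.absv_mult)
next
  case False
  then have x1: "absq x = 1" using x by simp
  obtain B where B: "residue_basis B" using residue_basis_ex by blast
  then have ind: "residue_indep B" and fin: "finite B"
    by (auto simp: residue_basis_def residue_indep_def)
  define I where "I = (\<Pi>\<^sub>E b\<in>B. {0..<int p})"
  define rep where "rep u = (\<Sum>b\<in>B. of_int (u b) * b)" for u :: "'a \<Rightarrow> int"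
  have card_I: "card I = p ^ f"
    using card_residue_basis[OF B] by (simp add: I_def card_PiE fin)
  have fin_I: "finite I" by (simp add: I_def finite_PiE fin)
  have rep_diff: "rep u - rep v = rep (\<lambda>b. u b - v b)" for u v
    by (simp add: rep_def left_diff_distrib sum_subtractf)
  \<comment> \<open>Residue independence makes the digits agree modulo \<open>p\<close>, and digits
    in \<open>{0..<int p}\<close> that agree modulo \<open>p\<close> are equal.\<close>
  have rep_inj: "u = v" if "u \<in> I" "v \<in> I" "absq (rep u - rep v) < 1" for u v
  proof (rule PiE_ext)
    show "u \<in> (\<Pi>\<^sub>E b\<in>B. {0..<int p})" "v \<in> (\<Pi>\<^sub>E b\<in>B. {0..<int p})" using that by (simp_all add: I_def)
    fix b assume b: "b \<in> B"
    have "\<forall>b\<in>B. int p dvd w b" if "absq (rep w) < 1" for w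
      using ind that unfolding residue_indep_def rep_def by blast
    then have "int p dvd u b - v b"
      using that(3) b unfolding rep_diff by blast
    moreover have "u b \<in> {0..<int p}" "v b \<in> {0..<int p}" using that b by (auto simp: I_def)
    ultimately show "u b = v b" by (metis atLeastLessThan_iff mod_eq_dvd_iff mod_pos_pos_trivial)
  qed
  have rep_le_1: "absq (rep u) \<le> 1" for u
    using absq_lincomb_le[OF ind, of 1 "\<lambda>b. of_int (u b)"]
    by (simp add: rep_def emb_of_int Qp.absv_of_int_le_1)
  have rep_ex: "\<exists>u\<in>I. absq (y - rep u) < 1" if y: "absq y \<le> 1" for y
  proof -
    obtain u where u: "absq (y - rep u) < 1"
      using residue_basis_spans_residues[OF B y] by (auto simp: rep_def)
    \<comment> \<open>Reducing the digits modulo \<open>p\<close> changes \<open>rep u\<close> by a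
      multiple of \<open>p\<close>; the restriction to \<open>B\<close> supplies the extensionality
      demanded by \<open>I\<close>.\<close>
    define v where "v = (\<lambda>b\<in>B. u b mod int p)"
    have "rep u - rep v = of_nat p * rep (\<lambda>b. u b div int p)"
    proof -
      have "rep u - rep v = (\<Sum>b\<in>B. of_int (int p * (u b div int p)) * b)"
        unfolding rep_diff unfolding rep_def
        by (intro sum.cong refl) (simp add: v_def minus_mod_eq_mult_div)
      then show ?thesis by (simp add: rep_def sum_distrib_left mult.assoc)
    qed
    then have "absq (rep u - rep v) = 1 / real p * absq (rep (\<lambda>b. u b div int p))"
      by (simp add: Qq.absv_mult absq_p)
    also have "\<dots> \<le> 1 / real p * 1" by (intro mult_left_mono rep_le_1) simp
    also have "\<dots> < 1" using p_gt_1 by simp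
    finally have "absq ((y - rep u) + (rep u - rep v)) < 1"
      using u Qq.absv_add_le_max by (smt (verit))
    moreover have "v \<in> I" using p_gt_1 by (auto simp: v_def I_def)
    ultimately show ?thesis by auto
  qed
  define z where "z = (\<lambda>b\<in>B. 0 :: int)"
  have z: "z \<in> I" "rep z = 0" using p_gt_1 by (auto simp: z_def I_def rep_def)
  define S where "S = I - {z}"
  have fin_S: "finite S" and card_S: "card S = p ^ f - 1"
    using fin_I card_I z by (simp_all add: S_def)
  have rep_unit: "absq (rep u) = 1" if "u \<in> S" for u
    using rep_inj[of u z] that z rep_le_1[of u] by (force simp: S_def)
  have "\<exists>v\<in>S. absq (x * rep u - rep v) < 1" if u: "u \<in> S" for u
  proof -
    have xu: "absq (x * rep u) = 1" using rep_unit[OF u] x1 by (simp add: Qq.absv_mult)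
    then obtain v where v: "v \<in> I" "absq (x * rep u - rep v) < 1" using rep_ex[of "x * rep u"] by auto
    then have "v \<noteq> z" using z xu by auto
    then show ?thesis using v by (auto simp: S_def)
  qed
  then obtain \<sigma> where \<sigma>: "\<And>u. u \<in> S \<Longrightarrow> \<sigma> u \<in> S" "\<And>u. u \<in> S \<Longrightarrow> absq (x * rep u - rep (\<sigma> u)) < 1"
    by metis
  \<comment> \<open>As \<open>absq x = 1\<close>, the factor \<open>x\<close> cancels from the
    difference.\<close>
  have inj: "inj_on \<sigma> S"
  proof (rule inj_onI)
    fix u v assume uv: "u \<in> S" "v \<in> S" "\<sigma> u = \<sigma> v"
    have "x * (rep u - rep v) = (x * rep u - rep (\<sigma> u)) + - (x * rep v - rep (\<sigma> v))"
      using uv by (simp add: algebra_simps)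
    also have "absq \<dots> < 1"
      using \<sigma>(2)[OF uv(1)] \<sigma>(2)[OF uv(2)] Qq.absv_add_le_max[of "x * rep u - rep (\<sigma> u)" "- (x * rep v - rep (\<sigma> v))"]
      unfolding Qq.absv_minus by linarith
    finally have "absq (rep u - rep v) < 1" by (simp add: Qq.absv_mult x1)
    then show "u = v" using rep_inj uv by (auto simp: S_def)
  qed
  then have "\<sigma> ` S = S" using fin_S \<sigma>(1) by (intro endo_inj_surj) auto
  then have perm: "(\<Prod>u\<in>S. rep (\<sigma> u)) = (\<Prod>u\<in>S. rep u)"
    using prod.reindex[OF inj, of rep] by simp
  \<comment> \<open>The product of the nonzero representatives has absolute value 1 and cancels,
    leaving \<open>x ^ (p ^ f - 1) \<equiv> 1\<close> modulo the maximal ideal.\<close>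
  have "absq ((\<Prod>u\<in>S. x * rep u) - (\<Prod>u\<in>S. rep (\<sigma> u))) < 1"
    using \<sigma> x rep_unit by (intro Qq.absv_prod_diff_less_1 fin_S) (auto simp: Qq.absv_mult)
  also have "(\<Prod>u\<in>S. x * rep u) - (\<Prod>u\<in>S. rep (\<sigma> u)) = (x ^ (p ^ f - 1) - 1) * (\<Prod>u\<in>S. rep u)"
    by (simp add: perm prod.distrib card_S left_diff_distrib)
  also have "absq \<dots> = absq (x ^ (p ^ f - 1) - 1)"
    by (simp add: Qq.absv_mult Qq.absv_prod rep_unit)
  finally have "absq (x * (x ^ (p ^ f - 1) - 1)) < 1" by (simp add: Qq.absv_mult x1)
  also have "x * (x ^ (p ^ f - 1) - 1) = x ^ (p ^ f) - x"
    using p_gt_1 by (simp add: right_diff_distrib flip: power_Suc)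
  finally show "absq (x ^ (p ^ f) - x) < 1" .
qed

end

text \<open>The extension supplies what \<open>Psi_evals_integral\<close> asks for: completeness,
  the bound \<open>1 / p\<close> for \<open>absq (of_nat q)\<close>, which comes from
  \<open>f \<ge> 1\<close>, and the Frobenius congruence.\<close>

theorem proposition2p5:
  fixes p f q :: nat
    and absp :: "'k::field_char_0 \<Rightarrow> real"
    and absq :: "'a::field_char_0 \<Rightarrow> real"
    and emb :: "'k \<Rightarrow> 'a"
    and a :: 'a
  assumes "prime p" and "f \<ge> 1" and "q = p ^ f"
    and "unramified_padic_extension absp p absq emb f"
  shows "nonarch_field.converges_at absq (Psi p q) a \<and>
         nonarch_field.value_at absq (Psi p q) a \<in> nonarch_field.ring_of_integers absq"
proof -
  interpret unramified_padic_extension absp p absq emb f by (rule assms(4))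
  have p: "p \<ge> 2" using p_gt_1 by simp
  have "p ^ 1 \<le> p ^ f" using p \<open>f \<ge> 1\<close> by (intro power_increasing) auto
  then have q: "q \<ge> 2" using p by (simp add: \<open>q = p ^ f\<close>)
  have "real p ^ 1 \<le> real p ^ f" using p \<open>f \<ge> 1\<close> by (intro power_increasing) auto
  then have q_small: "absq (of_nat q) \<le> 1 / real p"
    using p by (simp add: \<open>q = p ^ f\<close> Qq.absv_power absq_p field_simps)
  obtain s where s: "Qq.evals (Qq.lift_fps (Psi p q)) a s"
    using Qq.Psi_evals_ex[OF p q absq_p Qq_complete] by blast
  then have val: "Qq.has_value_at (Psi p q) a s" by (simp add: Qq.has_value_at_iff_evals)
  have "absq s \<le> 1"
    by (rule Qq.Psi_evals_integral[OF p q absq_p Qq_complete q_small _ s])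
       (simp add: \<open>q = p ^ f\<close> frobenius_congruence)
  with val show ?thesis
    by (auto simp: Qq.converges_at_def Qq.ring_of_integers_def Qq.value_at_eq)
qed

end
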